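(* Let $A$ be a finite abelian group, let $G$ be a polysurface group of length $n$ with filtration $1=G_0<G_1<\dots<G_n=G$, and let $1\to A\to\Gamma\xrightarrow{\phi}G\to1$ be a central extension. Let $G_1'$ be a finite index normal subgroup of $G_1$ with $[G_1:G_1']\le e(A)$, such that $G_1/G_1'$ is cyclic and the induced extension $1\to A\to\phi^{-1}(G_1')\to G_1'\to1$ is trivial. Let $i:G_1'\to\Gamma$ be a lift of $G_1'$. Then the normalizer $N_\Gamma(i(G_1'))$ is of finite index in $\Gamma$, with index less than $$|A|^{2e(A) g_1(G)}\cdot e(A)\,(e(A)!)^{2g_1(G)+|r(A)|}.$$
   Context: A surface group is the fundamental group of a closed orientable surface of genus at least $2$. A group $G$ is a polysurface group of length $n$ with filtration $1=G_0<G_1<\dots<G_n=G$ if each $G_i$ is normal in $G$ and each $G_i/G_{i-1}$ ($1\le i\le n$) is a surface group; $g_1(G)$ is the genus of the surface group $G_1$. For a finite abelian group $A$, $e(A)$ is its exponent and $r(A)$ is a generating set of $A$ of minimal size. A central extension is trivial if it is isomorphic as an extension to the product extension. A lift of $G_1'$ is a group homomorphism $i:G_1'\to\Gamma$ with $\phi\circ i$ equal to the inclusion $G_1'\hookrightarrow G$ (such a lift exists since the extension is trivial over $G_1'$).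
   Formalization: The strict bound is proved only for nontrivial A; for trivial A, where both the index and the bound equal 1 so "less than" fails, the index is shown to be at most the bound. Closed orientable surfaces are taken as glued 4g-gons realized in three-dimensional space. *)

theory Defs
  imports "HOL-Analysis.Analysis" "HOL-Algebra.Algebra"
begin

definition loops_at :: "'a::topological_space set \<Rightarrow> 'a \<Rightarrow> (real \<Rightarrow> 'a) set" where
  "loops_at S x = {p. path p \<and> path_image p \<subseteq> S \<and> pathstart p = x \<and> pathfinish p = x}"

definition path_class :: "'a::topological_space set \<Rightarrow> (real \<Rightarrow> 'a) \<Rightarrow> (real \<Rightarrow> 'a) set" where
  "path_class S p = {q. homotopic_paths S p q}"

definition fundamental_group :: "'a::topological_space set \<Rightarrow> 'a \<Rightarrow> (real \<Rightarrow> 'a) set monoid" where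
  "fundamental_group S x =
     \<lparr>carrier = path_class S ` loops_at S x,
      mult = (\<lambda>P Q. \<Union>p\<in>P. \<Union>q\<in>Q. path_class S (p +++ q)),
      one = path_class S (\<lambda>_. x)\<rparr>"

lemma path_class_eq:
  assumes "homotopic_paths S p q"
  shows "path_class S p = path_class S q"
proof (intro equalityI subsetI)
  fix r
  show "r \<in> path_class S q" if "r \<in> path_class S p"
    using homotopic_paths_trans[OF homotopic_paths_sym[OF assms]] that by (simp add: path_class_def)
  show "r \<in> path_class S p" if "r \<in> path_class S q"
    using homotopic_paths_trans[OF assms] that by (simp add: path_class_def)
qed

lemma fundamental_group_mult_class:
  assumes "p \<in> loops_at S x" "q \<in> loops_at S x"
  shows "path_class S p \<otimes>\<^bsub>fundamental_group S x\<^esub> path_class S q = path_class S (p +++ q)"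
proof -
  have refl: "p \<in> path_class S p" "q \<in> path_class S q"
    using assms by (simp_all add: loops_at_def path_class_def)
  have "path_class S (p' +++ q') = path_class S (p +++ q)"
    if "p' \<in> path_class S p" "q' \<in> path_class S q" for p' q'
  proof -
    have "homotopic_paths S (p +++ q) (p' +++ q')"
      using that assms by (intro homotopic_paths_join) (simp_all add: loops_at_def path_class_def)
    then show ?thesis
      by (rule path_class_eq[symmetric])
  qed
  then have "(\<Union>p'\<in>path_class S p. \<Union>q'\<in>path_class S q. path_class S (p' +++ q')) =
      (\<Union>p'\<in>path_class S p. \<Union>q'\<in>path_class S q. path_class S (p +++ q))"
    by (intro SUP_cong HOL.refl) simp_all
  also have "\<dots> = path_class S (p +++ q)"
    using refl by blast
  finally show ?thesis
    by (simp add: fundamental_group_def)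
qed

lemma group_fundamental_group:
  fixes S :: "'a::real_normed_vector set"
  assumes "x \<in> S"
  shows "group (fundamental_group S x)"
proof -
  let ?G = "fundamental_group S x"
  have const: "(\<lambda>_. x) = linepath x x"
    by (simp add: linepath_refl)
  have loop_const: "linepath x x \<in> loops_at S x"
    using assms by (auto simp: loops_at_def)
  have loop_join: "p +++ q \<in> loops_at S x" if "p \<in> loops_at S x" "q \<in> loops_at S x" for p q
    using that by (auto simp: loops_at_def path_image_join)
  have loop_rev: "reversepath p \<in> loops_at S x" if "p \<in> loops_at S x" for p
    using that by (auto simp: loops_at_def)
  have carr: "carrier ?G = path_class S ` loops_at S x"
    and one: "\<one>\<^bsub>?G\<^esub> = path_class S (linepath x x)"
    by (simp_all add: fundamental_group_def const)
  note mc = fundamental_group_mult_class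
  show ?thesis
  proof (rule groupI)
    fix P Q assume "P \<in> carrier ?G" "Q \<in> carrier ?G"
    then show "P \<otimes>\<^bsub>?G\<^esub> Q \<in> carrier ?G"
      by (auto simp: carr mc loop_join)
  next
    show "\<one>\<^bsub>?G\<^esub> \<in> carrier ?G"
      using loop_const by (simp add: carr one)
  next
    fix P Q R assume "P \<in> carrier ?G" "Q \<in> carrier ?G" "R \<in> carrier ?G"
    then obtain p q r where pqr: "p \<in> loops_at S x" "q \<in> loops_at S x" "r \<in> loops_at S x"
      "P = path_class S p" "Q = path_class S q" "R = path_class S r"
      by (auto simp: carr)
    then have "homotopic_paths S (p +++ (q +++ r)) ((p +++ q) +++ r)"
      by (intro homotopic_paths_assoc) (auto simp: loops_at_def)
    then have "path_class S (p +++ (q +++ r)) = path_class S ((p +++ q) +++ r)"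
      by (rule path_class_eq)
    then show "P \<otimes>\<^bsub>?G\<^esub> Q \<otimes>\<^bsub>?G\<^esub> R = P \<otimes>\<^bsub>?G\<^esub> (Q \<otimes>\<^bsub>?G\<^esub> R)"
      using pqr by (simp add: mc loop_join)
  next
    fix P assume "P \<in> carrier ?G"
    then obtain p where p: "p \<in> loops_at S x" "P = path_class S p"
      by (auto simp: carr)
    have "homotopic_paths S (linepath x x +++ p) p"
      using p by (intro homotopic_paths_lid') (auto simp: loops_at_def)
    then show "\<one>\<^bsub>?G\<^esub> \<otimes>\<^bsub>?G\<^esub> P = P"
      using p by (simp add: mc one loop_const path_class_eq)
    have "homotopic_paths S (reversepath p +++ p) (linepath x x)"
      using p homotopic_paths_linv[of p S] by (auto simp: loops_at_def)
    then have "path_class S (reversepath p) \<otimes>\<^bsub>?G\<^esub> P = \<one>\<^bsub>?G\<^esub>"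
      using p by (simp add: mc one loop_rev path_class_eq)
    then show "\<exists>Q\<in>carrier ?G. Q \<otimes>\<^bsub>?G\<^esub> P = \<one>\<^bsub>?G\<^esub>"
      using p loop_rev by (auto simp: carr)
  qed
qed

text \<open>The boundary of the closed unit disc is divided into \<open>4 * g\<close> arcs of equal length, read
  as the edges of a polygon. The point at parameter \<open>s\<close> lies at fraction \<open>frac s\<close> of the edge
  number \<open>floor s\<close>.\<close>

definition polygon_point :: "nat \<Rightarrow> real \<Rightarrow> complex" where
  "polygon_point g s = cis (2 * pi * s / (4 * real g))"

text \<open>The edge identifications of the boundary word
  \<open>a\<^sub>0 b\<^sub>0 a\<^sub>0\<^sup>-\<^sup>1 b\<^sub>0\<^sup>-\<^sup>1 a\<^sub>1 b\<^sub>1 a\<^sub>1\<^sup>-\<^sup>1 b\<^sub>1\<^sup>-\<^sup>1 \<dots>\<close>.\<close>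

definition edge_gluing :: "nat \<Rightarrow> complex \<Rightarrow> complex \<Rightarrow> bool" where
  "edge_gluing g z w \<longleftrightarrow> (\<exists>j<g. \<exists>t\<in>{0..1}.
     (z = polygon_point g (4 * real j + t) \<and> w = polygon_point g (4 * real j + 3 - t)) \<or>
     (z = polygon_point g (4 * real j + 1 + t) \<and> w = polygon_point g (4 * real j + 4 - t)))"

text \<open>A closed orientable surface of genus \<open>g \<ge> 1\<close> is a space homeomorphic to the quotient of the
  \<open>4 * g\<close>-gon by the above edge identifications.\<close>

definition closed_orientable_surface :: "nat \<Rightarrow> 'a::topological_space set \<Rightarrow> bool" where
  "closed_orientable_surface g S \<longleftrightarrow> 1 \<le> g \<and>
     (\<exists>q. quotient_map (top_of_set (cball 0 1)) (top_of_set S) q \<and>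
       (\<forall>z\<in>cball 0 1. \<forall>w\<in>cball 0 1. q z = q w \<longleftrightarrow> equivclp (edge_gluing g) z w))"

text \<open>Restricting to surfaces in three-dimensional Euclidean space is no loss of generality: every
  closed orientable surface embeds there.\<close>

definition surface_group_of_genus :: "nat \<Rightarrow> ('h, 'm) monoid_scheme \<Rightarrow> bool" where
  "surface_group_of_genus g H \<longleftrightarrow> 2 \<le> g \<and>
     (\<exists>(S :: (real ^ 3) set) x. closed_orientable_surface g S \<and> x \<in> S \<and>
       H \<cong> fundamental_group S x)"

definition surface_group :: "('h, 'm) monoid_scheme \<Rightarrow> bool" where
  "surface_group H \<longleftrightarrow> (\<exists>g. surface_group_of_genus g H)"

definition polysurface_group :: "('g, 'm) monoid_scheme \<Rightarrow> nat \<Rightarrow> (nat \<Rightarrow> 'g set) \<Rightarrow> bool" where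
  "polysurface_group G n F \<longleftrightarrow>
     group G \<and> F 0 = {\<one>\<^bsub>G\<^esub>} \<and> F n = carrier G \<and>
     (\<forall>k\<le>n. F k \<lhd> G) \<and>
     (\<forall>k<n. F k \<subseteq> F (Suc k) \<and> surface_group (G\<lparr>carrier := F (Suc k)\<rparr> Mod F k))"

definition group_exponent :: "('a, 'm) monoid_scheme \<Rightarrow> nat" where
  "group_exponent A = (LEAST e. 0 < e \<and> (\<forall>a\<in>carrier A. a [^]\<^bsub>A\<^esub> e = \<one>\<^bsub>A\<^esub>))"

definition generating_set :: "('a, 'm) monoid_scheme \<Rightarrow> 'a set \<Rightarrow> bool" where
  "generating_set A R \<longleftrightarrow> R \<subseteq> carrier A \<and> generate A R = carrier A"

definition min_size_generating_set :: "('a, 'm) monoid_scheme \<Rightarrow> 'a set \<Rightarrow> bool" where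
  "min_size_generating_set A R \<longleftrightarrow>
     generating_set A R \<and> finite R \<and> (\<forall>R'. generating_set A R' \<and> finite R' \<longrightarrow> card R \<le> card R')"

definition central_extension ::
    "('a, 'm) monoid_scheme \<Rightarrow> ('a \<Rightarrow> 'e) \<Rightarrow> ('e, 'n) monoid_scheme \<Rightarrow> ('e \<Rightarrow> 'g) \<Rightarrow>
     ('g, 'o) monoid_scheme \<Rightarrow> bool" where
  "central_extension A \<iota> \<Gamma> \<phi> G \<longleftrightarrow>
     group A \<and> group \<Gamma> \<and> group G \<and>
     \<iota> \<in> hom A \<Gamma> \<and> inj_on \<iota> (carrier A) \<and>
     \<phi> \<in> hom \<Gamma> G \<and> \<phi> ` carrier \<Gamma> = carrier G \<and>
     kernel \<Gamma> G \<phi> = \<iota> ` carrier A \<and>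
     (\<forall>a\<in>carrier A. \<forall>x\<in>carrier \<Gamma>. \<iota> a \<otimes>\<^bsub>\<Gamma>\<^esub> x = x \<otimes>\<^bsub>\<Gamma>\<^esub> \<iota> a)"

definition trivial_extension ::
    "('a, 'm) monoid_scheme \<Rightarrow> ('a \<Rightarrow> 'e) \<Rightarrow> ('e, 'n) monoid_scheme \<Rightarrow> ('e \<Rightarrow> 'g) \<Rightarrow>
     ('g, 'o) monoid_scheme \<Rightarrow> bool" where
  "trivial_extension A \<iota> \<Gamma> \<phi> G \<longleftrightarrow>
     (\<exists>f \<in> iso \<Gamma> (A \<times>\<times> G).
        (\<forall>a\<in>carrier A. f (\<iota> a) = (a, \<one>\<^bsub>G\<^esub>)) \<and> (\<forall>x\<in>carrier \<Gamma>. snd (f x) = \<phi> x))"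

definition is_lift ::
    "('e, 'n) monoid_scheme \<Rightarrow> ('e \<Rightarrow> 'g) \<Rightarrow> ('g, 'o) monoid_scheme \<Rightarrow> 'g set \<Rightarrow> ('g \<Rightarrow> 'e) \<Rightarrow> bool" where
  "is_lift \<Gamma> \<phi> G H i \<longleftrightarrow> i \<in> hom (G\<lparr>carrier := H\<rparr>) \<Gamma> \<and> (\<forall>x\<in>H. \<phi> (i x) = x)"

end

theory Submission
  imports Defs
begin

text \<open>A conjugate of the lifted subgroup is again a lifted subgroup, over a conjugate of \<open>G1'\<close> inside
  \<open>F 1\<close>, so it suffices to count pairs of such a conjugate and a lift of it. If \<open>F 1\<close> is generated by
  \<open>2 * g1\<close> elements, a conjugate of \<open>G1'\<close>, being the kernel of a homomorphism onto \<open>F 1 / G1'\<close>, is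
  one of at most \<open>m ^ (2 * g1)\<close> subgroups, where \<open>m\<close> is the index of \<open>G1'\<close>. By Schreier's lemma it is
  generated by \<open>2 * m * g1\<close> elements, so it has at most \<open>card (carrier A) ^ (2 * m * g1)\<close> lifts.

  That \<open>2 * g1\<close> elements generate the surface group is seen on the \<open>4 * g1\<close>-gon. The polygon being
  convex, a glued pair of points defines a loop that runs to the first point inside the polygon and
  returns from the second. This loop class is constant along each of the \<open>2 * g1\<close> pairs of sides.
  The surface is locally contractible, compatibly with the polygon, and therefore every loop is a
  product of such loops.\<close>

section \<open>Fundamental groups of quotients of convex sets\<close>

text \<open>The gluing map \<open>q\<close> is not a covering: a path of the surface that crosses a
  glued side has no continuous lift to the polygon. What is asked instead is that short paths be
  homotopic, with fixed ends, to images of paths of the polygon. A preimage chosen at the end of one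
  short path need not be the one chosen at the start of the next, and this ambiguity is exactly what
  the loops of glued pairs measure. In the count, all homomorphisms have the same target
  \<open>F 1 / G1'\<close>, and two elements of \<Gamma> over one element of \<open>G\<close> differ
  by an element of the kernel of \<open>\<phi>\<close>; so finitely many values suffice although the
  conjugating element varies without bound. With \<open>m\<close> at most the exponent e, the count
  gives \<open>e ^ (2 * g1)\<close> times \<open>card (carrier A) ^ (2 * e * g1)\<close>. The first
  factor is absorbed by the factorials because e is at most e!, and the separate factor e makes the
  inequality strict as soon as \<open>A\<close> is nontrivial.\<close>

lemma homotopic_paths_cancel_middle:
  fixes S :: "'a::real_normed_vector set"
  assumes "path p" "path_image p \<subseteq> S" "path e" "path_image e \<subseteq> S" "path r" "path_image r \<subseteq> S"
    and "pathfinish p = pathstart e" "pathstart r = pathstart e"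
  shows "homotopic_paths S ((p +++ e) +++ (reversepath e +++ r)) (p +++ r)"
proof -
  have as: "homotopic_paths S (p +++ (e +++ (reversepath e +++ r))) ((p +++ e) +++ (reversepath e +++ r))"
    using assms by (intro homotopic_paths_assoc) (auto simp: path_image_join)
  moreover have "homotopic_paths S (e +++ (reversepath e +++ r)) ((e +++ reversepath e) +++ r)"
    using assms by (intro homotopic_paths_assoc) auto
  moreover have "homotopic_paths S ((e +++ reversepath e) +++ r) (linepath (pathstart e) (pathstart e) +++ r)"
    using assms by (intro homotopic_paths_join homotopic_paths_rinv) auto
  moreover have "homotopic_paths S (linepath (pathstart e) (pathstart e) +++ r) r"
    using assms by (intro homotopic_paths_lid') auto
  ultimately have er: "homotopic_paths S (e +++ (reversepath e +++ r)) r"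
    by (meson homotopic_paths_trans)
  have "homotopic_paths S (p +++ (e +++ (reversepath e +++ r))) (p +++ r)"
    using assms er by (intro homotopic_paths_join) auto
  with as show ?thesis
    by (meson homotopic_paths_trans homotopic_paths_sym)
qed

locale convex_quotient =
  fixes D :: "'b::real_normed_vector set" and S :: "'a::real_normed_vector set"
    and q :: "'b \<Rightarrow> 'a" and z0 :: 'b
  assumes convex: "convex D" and cont: "continuous_on D q" and img: "q ` D = S" and z0: "z0 \<in> D"
begin

definition ray :: "'b \<Rightarrow> real \<Rightarrow> 'a" where
  "ray z = q \<circ> linepath z0 z"

definition ray_loop :: "'b \<Rightarrow> 'b \<Rightarrow> (real \<Rightarrow> 'a) set" where
  "ray_loop z w = path_class S (ray z +++ reversepath (ray w))"

lemma path_image_under_quotient: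
  assumes "path u" "path_image u \<subseteq> D"
  shows "path (q \<circ> u)" "path_image (q \<circ> u) \<subseteq> S"
proof -
  show "path (q \<circ> u)"
    using assms cont by (meson continuous_on_subset path_continuous_image)
  show "path_image (q \<circ> u) \<subseteq> S"
    using assms(2) img by (auto simp: path_image_compose)
qed

text \<open>A convex set is simply connected, so any two paths of \<open>D\<close> with the same
  ends are homotopic there, and \<open>q\<close> carries the homotopy to \<open>S\<close>.\<close>

lemma homotopic_in_quotient:
  assumes "path u" "path_image u \<subseteq> D" "path v" "path_image v \<subseteq> D"
    and "pathstart u = pathstart v" "pathfinish u = pathfinish v"
  shows "homotopic_paths S (q \<circ> u) (q \<circ> v)"
proof (rule homotopic_paths_continuous_image[OF _ cont])
  show "homotopic_paths D u v"
    using convex_imp_simply_connected[OF convex] assms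
    unfolding simply_connected_eq_homotopic_paths by metis
qed (use img in auto)

lemma ray:
  assumes "z \<in> D"
  shows "path (ray z)" "path_image (ray z) \<subseteq> S" "pathstart (ray z) = q z0" "pathfinish (ray z) = q z"
proof -
  have "path_image (linepath z0 z) \<subseteq> D"
    using assms z0 convex by (simp add: closed_segment_subset)
  then show "path (ray z)" "path_image (ray z) \<subseteq> S"
    unfolding ray_def by (simp_all only: path_image_under_quotient path_linepath)
qed (simp_all add: ray_def pathstart_compose pathfinish_compose)

lemma ray_extend:
  assumes "path u" "path_image u \<subseteq> D"
  shows "homotopic_paths S (ray (pathfinish u)) (ray (pathstart u) +++ (q \<circ> u))"
proof -
  have ends: "pathstart u \<in> D" "pathfinish u \<in> D"
    using assms(2) by auto
  have "homotopic_paths S (q \<circ> linepath z0 (pathfinish u)) (q \<circ> (linepath z0 (pathstart u) +++ u))"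
    using assms z0 convex ends
    by (intro homotopic_in_quotient) (auto simp: path_image_join closed_segment_subset)
  then show ?thesis
    by (simp add: ray_def path_compose_join)
qed

lemma ray_loop_in_loops:
  assumes "z \<in> D" "w \<in> D" "q z = q w"
  shows "ray z +++ reversepath (ray w) \<in> loops_at S (q z0)"
  using assms ray by (simp add: loops_at_def path_image_join)

lemma ray_loop_carrier:
  assumes "z \<in> D" "w \<in> D" "q z = q w"
  shows "ray_loop z w \<in> carrier (fundamental_group S (q z0))"
  using ray_loop_in_loops[OF assms] by (simp add: ray_loop_def fundamental_group_def)

text \<open>The way back along the ray of \<open>w\<close> and out again cancels. This cocycle rule
  allows a chain of elementary gluings to be treated one link at a time.\<close>

lemma ray_loop_mult:
  assumes "z \<in> D" "w \<in> D" "q z = q w" "v \<in> D" "q v = q w"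
  shows "ray_loop z w \<otimes>\<^bsub>fundamental_group S (q z0)\<^esub> ray_loop w v = ray_loop z v"
proof -
  have "homotopic_paths S ((ray z +++ reversepath (ray w)) +++ (reversepath (reversepath (ray w)) +++ reversepath (ray v)))
     (ray z +++ reversepath (ray v))"
    using assms ray by (intro homotopic_paths_cancel_middle) simp_all
  then show ?thesis
    using assms by (simp add: ray_loop_def fundamental_group_mult_class ray_loop_in_loops path_class_eq)
qed

lemma ray_loop_self:
  assumes "z \<in> D"
  shows "ray_loop z z = \<one>\<^bsub>fundamental_group S (q z0)\<^esub>"
proof -
  interpret group "fundamental_group S (q z0)"
    using z0 img by (intro group_fundamental_group) auto
  show ?thesis
    using ray_loop_mult[of z z z] ray_loop_carrier[of z z] assms by (simp add: l_cancel_one)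
qed

lemma ray_loop_inverse:
  assumes "z \<in> D" "w \<in> D" "q z = q w"
  shows "ray_loop w z = inv\<^bsub>fundamental_group S (q z0)\<^esub> ray_loop z w"
proof -
  interpret group "fundamental_group S (q z0)"
    using z0 img by (intro group_fundamental_group) auto
  have "ray_loop w z \<otimes>\<^bsub>fundamental_group S (q z0)\<^esub> ray_loop z w = \<one>\<^bsub>fundamental_group S (q z0)\<^esub>"
    using assms by (simp add: ray_loop_mult ray_loop_self)
  then show ?thesis
    using assms by (simp add: inv_equality ray_loop_carrier)
qed

text \<open>Moving both ends of a glued pair along paths with the same image inserts that image followed
  by its reverse.\<close>

lemma ray_loop_transport:
  assumes "path u" "path_image u \<subseteq> D" "path v" "path_image v \<subseteq> D"
    and "\<And>t. t \<in> {0..1} \<Longrightarrow> q (u t) = q (v t)"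
  shows "ray_loop (pathfinish u) (pathfinish v) = ray_loop (pathstart u) (pathstart v)"
proof -
  have ends: "pathstart u \<in> D" "pathstart v \<in> D" "pathfinish u \<in> D" "pathfinish v \<in> D"
    using assms(2,4) by auto
  have qs: "q (pathstart u) = q (pathstart v)" "q (pathfinish u) = q (pathfinish v)"
    using assms(5) by (simp_all add: pathstart_def pathfinish_def)
  note pu = path_image_under_quotient[OF assms(1,2)] and pv = path_image_under_quotient[OF assms(3,4)]
  have "homotopic_paths S (q \<circ> v) (q \<circ> u)"
    using pv assms(5) by (intro homotopic_paths_eq) auto
  then have "homotopic_paths S (ray (pathstart v) +++ (q \<circ> v)) (ray (pathstart v) +++ (q \<circ> u))"
    using ray[OF ends(2)] by (intro homotopic_paths_join) (auto simp: pathstart_compose)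
  then have "homotopic_paths S (ray (pathfinish v)) (ray (pathstart v) +++ (q \<circ> u))"
    using ray_extend[OF assms(3,4)] by (rule homotopic_paths_trans[rotated])
  then have "homotopic_paths S (reversepath (ray (pathfinish v))) (reversepath (ray (pathstart v) +++ (q \<circ> u)))"
    by (simp only: homotopic_paths_reversepath)
  moreover have "reversepath (ray (pathstart v) +++ (q \<circ> u)) = reversepath (q \<circ> u) +++ reversepath (ray (pathstart v))"
    using ray[OF ends(2)] qs by (simp add: reversepath_joinpaths pathstart_compose)
  ultimately have "homotopic_paths S (ray (pathfinish u) +++ reversepath (ray (pathfinish v)))
      ((ray (pathstart u) +++ (q \<circ> u)) +++ (reversepath (q \<circ> u) +++ reversepath (ray (pathstart v))))"
    using ray_extend[OF assms(1,2)] ray[OF ends(3)] ray[OF ends(4)] qs by (intro homotopic_paths_join) auto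
  moreover have "homotopic_paths S ((ray (pathstart u) +++ (q \<circ> u)) +++ (reversepath (q \<circ> u) +++ reversepath (ray (pathstart v))))
     (ray (pathstart u) +++ reversepath (ray (pathstart v)))"
    using pu ray[OF ends(1)] ray[OF ends(2)] qs
    by (intro homotopic_paths_cancel_middle) (simp_all add: pathstart_compose)
  ultimately show ?thesis
    unfolding ray_loop_def by (intro path_class_eq) (rule homotopic_paths_trans)
qed

text \<open>Lifting is asked only up to homotopy with fixed ends, since a path near a glued side may
  cross it. The path \<open>u\<close> may start at any preimage of \<open>y\<close>, and
  \<open>U\<close> confines \<open>w\<close> but not the homotopy.\<close>

definition locally_liftable :: "'a \<Rightarrow> bool" where
  "locally_liftable y \<longleftrightarrow> (\<exists>U. openin (top_of_set S) U \<and> y \<in> U \<and>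
     (\<forall>w. path w \<and> path_image w \<subseteq> U \<and> pathstart w = y \<longrightarrow>
       (\<exists>u. path u \<and> path_image u \<subseteq> D \<and> homotopic_paths S w (q \<circ> u))))"

text \<open>For a loop \<open>p\<close>, consider the class of \<open>p\<close> restricted to \<open>[0, t]\<close> and closed up by a ray. Its
  coset modulo the subgroup generated by \<open>Y\<close> does not depend on the ray and is locally constant
  in \<open>t\<close>.\<close>

theorem fundamental_group_generated:
  assumes lift: "\<And>y. y \<in> S \<Longrightarrow> locally_liftable y"
    and Y: "Y \<subseteq> carrier (fundamental_group S (q z0))"
    and loops: "\<And>z w. z \<in> D \<Longrightarrow> w \<in> D \<Longrightarrow> q z = q w \<Longrightarrow>
      ray_loop z w \<in> generate (fundamental_group S (q z0)) Y"
  shows "generate (fundamental_group S (q z0)) Y = carrier (fundamental_group S (q z0))"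
proof
  let ?P = "fundamental_group S (q z0)"
  let ?H = "generate ?P Y"
  have x: "q z0 \<in> S"
    using z0 img by auto
  interpret group ?P
    by (rule group_fundamental_group[OF x])
  have H: "subgroup ?H ?P"
    using generate_is_subgroup[OF Y] .
  show "?H \<subseteq> carrier ?P"
    using subgroup.subset[OF H] .
  show "carrier ?P \<subseteq> ?H"
  proof
    fix c assume "c \<in> carrier ?P"
    then obtain p where p: "p \<in> loops_at S (q z0)" and c: "c = path_class S p"
      by (auto simp: fundamental_group_def)
    have pp: "path p" "path_image p \<subseteq> S" "pathstart p = q z0" "pathfinish p = q z0"
      using p by (auto simp: loops_at_def)
    have pS: "p t \<in> S" if "t \<in> {0..1}" for t
      using pp(2) that by (auto simp: path_image_def)
    define k where "k t z = subpath 0 t p +++ reversepath (ray z)" for t z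
    have sub: "path (subpath s t p)" "path_image (subpath s t p) \<subseteq> S"
      "pathstart (subpath s t p) = p s" "pathfinish (subpath s t p) = p t"
      if "s \<in> {0..1}" "t \<in> {0..1}" for s t
      using that pp path_image_subpath_subset[of s t p] by auto
    have p0: "p 0 = q z0"
      using pp(3) by (simp add: pathstart_def)
    have k_loop: "k t z \<in> loops_at S (q z0)" if "t \<in> {0..1}" "z \<in> D" "q z = p t" for t z
      using that sub[of 0 t] ray[of z] p0 by (auto simp: k_def loops_at_def path_image_join)
    \<comment> \<open>Inserting the ray of \<open>z\<close> back and forth multiplies the class by
      \<open>ray_loop z w\<close>, which lies in \<open>?H\<close>.\<close>
    have k_change: "path_class S (k t w) \<in> ?H"
      if "t \<in> {0..1}" "z \<in> D" "q z = p t" "w \<in> D" "q w = p t" "path_class S (k t z) \<in> ?H" for t z w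
    proof -
      have "homotopic_paths S ((subpath 0 t p +++ reversepath (ray z)) +++
            (reversepath (reversepath (ray z)) +++ reversepath (ray w)))
          (subpath 0 t p +++ reversepath (ray w))"
        using that sub[of 0 t] ray[of z] ray[of w] by (intro homotopic_paths_cancel_middle) simp_all
      then have "path_class S (k t z) \<otimes>\<^bsub>?P\<^esub> ray_loop z w = path_class S (k t w)"
        using that by (simp add: ray_loop_def fundamental_group_mult_class ray_loop_in_loops k_loop)
          (simp add: k_def path_class_eq)
      moreover have "ray_loop z w \<in> ?H"
        using loops that by simp
      ultimately show ?thesis
        using subgroup.m_closed[OF H that(6)] by (metis (no_types))
    qed
    define good where "good t \<longleftrightarrow> (\<exists>z\<in>D. q z = p t \<and> path_class S (k t z) \<in> ?H)" for t
    have good_iff: "good t \<longleftrightarrow> path_class S (k t z) \<in> ?H" if "t \<in> {0..1}" "z \<in> D" "q z = p t" for t z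
      unfolding good_def using k_change[OF that(1) _ _ that(2,3)] that(2,3) by blast
    have "good 1"
    proof (rule connected_induction_simple[of "{0..1::real}" 0 1 good])
      show "good 0"
      proof -
        have "ray z0 = linepath (q z0) (q z0)"
          by (auto simp: ray_def linepath_refl)
        then have "k 0 z0 = ray z0 +++ reversepath (ray z0)"
          using p0 by (simp add: k_def subpath_def linepath_def fun_eq_iff joinpaths_def)
        then have "path_class S (k 0 z0) = ray_loop z0 z0"
          by (simp add: ray_loop_def)
        then show ?thesis
          unfolding good_def using z0 p0 loops[of z0 z0] by auto
      qed
    next
      fix t0 :: real assume t0: "t0 \<in> {0..1}"
      from lift[OF pS[OF t0]] obtain U where U: "openin (top_of_set S) U" "p t0 \<in> U"
        and Ulift: "\<And>w. path w \<Longrightarrow> path_image w \<subseteq> U \<Longrightarrow> pathstart w = p t0 \<Longrightarrow>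
          \<exists>u. path u \<and> path_image u \<subseteq> D \<and> homotopic_paths S w (q \<circ> u)"
        unfolding locally_liftable_def by blast
      have "openin (top_of_set {0..1}) ({0..1} \<inter> p -` U)"
        using pp(1,2) U(1) unfolding path_def path_image_def
        by (intro continuous_openin_preimage[where T=S]) auto
      then obtain e where e: "e > 0" "\<And>t. t \<in> {0..1} \<Longrightarrow> dist t t0 < e \<Longrightarrow> p t \<in> U"
        using t0 U(2) unfolding openin_euclidean_subtopology_iff by blast
      \<comment> \<open>Up to homotopy the piece of \<open>p\<close> from \<open>t0\<close> to
        \<open>t\<close> is the image of a path \<open>u\<close> of \<open>D\<close>, which
        \<open>ray_extend\<close> absorbs into the ray to its end. Hence the loops for
        \<open>t\<close> and \<open>t0\<close>, closed up at the two ends of \<open>u\<close>, are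
        homotopic.\<close>
      have step: "good t \<longleftrightarrow> good t0" if t: "t \<in> {0..1}" "dist t t0 < e" for t
      proof -
        have "path_image (subpath t0 t p) \<subseteq> U"
        proof
          fix y assume "y \<in> path_image (subpath t0 t p)"
          then obtain s where s: "s \<in> closed_segment t0 t" "y = p s"
            using t0 t by (auto simp: path_image_subpath_gen)
          then have "s \<in> {0..1}"
            using t0 t(1) by (auto simp: closed_segment_eq_real_ivl split: if_splits)
          moreover have "dist s t0 < e"
            using s(1) t(2) by (auto simp: closed_segment_eq_real_ivl dist_real_def split: if_splits)
          ultimately show "y \<in> U"
            using e(2) s by simp
        qed
        then obtain u where u: "path u" "path_image u \<subseteq> D" and hom: "homotopic_paths S (subpath t0 t p) (q \<circ> u)"
          using Ulift[of "subpath t0 t p"] sub[OF t0 t(1)] by auto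
        have ends: "pathstart u \<in> D" "pathfinish u \<in> D"
          using u(2) by auto
        have qu: "q (pathstart u) = p t0" "q (pathfinish u) = p t"
          using homotopic_paths_imp_pathstart[OF hom] homotopic_paths_imp_pathfinish[OF hom] sub[OF t0 t(1)]
          by (simp_all add: pathstart_compose pathfinish_compose)
        note pu = path_image_under_quotient[OF u]
        have z: "0 \<in> {0..1::real}" by simp
        have "homotopic_paths S (subpath 0 t0 p +++ subpath t0 t p) (subpath 0 t p)"
          using pp t0 t by (intro homotopic_join_subpaths) auto
        moreover have "homotopic_paths S (subpath 0 t0 p +++ subpath t0 t p) (subpath 0 t0 p +++ (q \<circ> u))"
          using hom sub[OF z t0] sub[OF t0 t(1)] by (intro homotopic_paths_join) simp_all
        ultimately have 1: "homotopic_paths S (subpath 0 t p) (subpath 0 t0 p +++ (q \<circ> u))"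
          by (meson homotopic_paths_trans homotopic_paths_sym)
        have "homotopic_paths S (reversepath (ray (pathfinish u))) (reversepath (ray (pathstart u) +++ (q \<circ> u)))"
          using ray_extend[OF u] by (simp only: homotopic_paths_reversepath)
        moreover have "reversepath (ray (pathstart u) +++ (q \<circ> u)) = reversepath (q \<circ> u) +++ reversepath (ray (pathstart u))"
          using ray[OF ends(1)] by (simp add: reversepath_joinpaths pathstart_compose)
        ultimately have "homotopic_paths S (k t (pathfinish u))
            ((subpath 0 t0 p +++ (q \<circ> u)) +++ (reversepath (q \<circ> u) +++ reversepath (ray (pathstart u))))"
          unfolding k_def using 1 sub[OF z t(1)] ray[OF ends(2)] qu
          by (intro homotopic_paths_join) auto
        moreover have "homotopic_paths S
            ((subpath 0 t0 p +++ (q \<circ> u)) +++ (reversepath (q \<circ> u) +++ reversepath (ray (pathstart u))))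
            (k t0 (pathstart u))"
          unfolding k_def using pu sub[OF z t0] ray[OF ends(1)] qu
          by (intro homotopic_paths_cancel_middle) (simp_all add: pathstart_compose)
        ultimately have "path_class S (k t (pathfinish u)) = path_class S (k t0 (pathstart u))"
          by (intro path_class_eq) (rule homotopic_paths_trans)
        then show ?thesis
          using good_iff[OF t(1) ends(2) qu(2)] good_iff[OF t0 ends(1) qu(1)] by simp
      qed
      show "\<exists>T. openin (top_of_set {0..1}) T \<and> t0 \<in> T \<and> (\<forall>x\<in>T. \<forall>y\<in>T. good x \<longrightarrow> good y)"
      proof (intro exI conjI ballI impI)
        show "openin (top_of_set {0..1}) ({0..1} \<inter> ball t0 e)"
          by (simp add: openin_open_Int)
        show "t0 \<in> {0..1} \<inter> ball t0 e"
          using t0 e(1) by simp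
        fix s t assume "s \<in> {0..1} \<inter> ball t0 e" "t \<in> {0..1} \<inter> ball t0 e" "good s"
        then show "good t"
          using step[of s] step[of t] by (simp add: dist_commute)
      qed
    qed (auto intro: connected_Icc)
    moreover have "p 1 = q z0"
      using pp(4) by (simp add: pathfinish_def)
    ultimately have "path_class S (k 1 z0) \<in> ?H"
      using good_iff[of 1 z0] z0 by simp
    \<comment> \<open>The ray of the base point is constant, so closing up with it at time 1 leaves
      \<open>p\<close> itself.\<close>
    moreover have "homotopic_paths S (k 1 z0) p"
    proof -
      have "reversepath (ray z0) = linepath (q z0) (q z0)"
        by (auto simp: ray_def linepath_refl reversepath_def)
      then show ?thesis
        using pp by (simp add: k_def homotopic_paths_rid')
    qed
    ultimately show "c \<in> ?H"
      by (simp add: c path_class_eq)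
  qed
qed

end

section \<open>The glued polygon\<close>

text \<open>A continuous map from a compact set to a Hausdorff space is closed, hence a quotient map
  onto its image, and \<open>h\<close> is constant on its fibres. This yields both the local inverse
  of \<open>q\<close> inside the disc and the contraction of a neighbourhood of a boundary
  point.\<close>

lemma continuous_factor_through_compact:
  fixes f :: "'a::topological_space \<Rightarrow> 'b::t2_space" and h :: "'a \<Rightarrow> 'c::topological_space"
  assumes "compact C" "continuous_on C f" "continuous_on C h"
    and "\<And>x y. x \<in> C \<Longrightarrow> y \<in> C \<Longrightarrow> f x = f y \<Longrightarrow> h x = h y"
  obtains k where "continuous_on (f ` C) k" "\<And>x. x \<in> C \<Longrightarrow> k (f x) = h x"
proof
  define k where "k = h \<circ> inv_into C f"
  show kf: "k (f x) = h x" if "x \<in> C" for x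
    using that assms(4)[of "inv_into C f (f x)" x] by (simp add: k_def f_inv_into_f inv_into_into)
  show "continuous_on (f ` C) k"
    unfolding continuous_closedin_preimage_eq
  proof (intro allI impI)
    fix B :: "'c set" assume "closed B"
    then have "closedin (top_of_set C) (C \<inter> h -` B)"
      using assms(3) by (simp add: continuous_closedin_preimage)
    then have "compact (C \<inter> h -` B)"
      using assms(1) closedin_compact by blast
    then have "closed (f ` (C \<inter> h -` B))"
      using assms(2) by (meson compact_continuous_image compact_imp_closed continuous_on_subset inf_le1)
    moreover have "f ` C \<inter> k -` B = f ` C \<inter> f ` (C \<inter> h -` B)"
      using kf by force
    ultimately show "closedin (top_of_set (f ` C)) (f ` C \<inter> k -` B)"
      by (simp add: closedin_closed_Int)
  qed
qed

text \<open>On the square with coordinates \<open>t\<close> and \<sigma>, the map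
  \<open>k (w t, \<sigma>)\<close> is constant on the left and bottom edges. The top and right edges
  are the two paths, and each is deformed into the diagonal \<open>k (w t, t)\<close>.\<close>

lemma contraction_homotopic_paths:
  fixes k :: "'a::topological_space \<times> real \<Rightarrow> 'b::topological_space"
  assumes k: "continuous_on (K \<times> {0..1}) k" "k ` (K \<times> {0..1}) \<subseteq> S"
    and w: "path w" "path_image w \<subseteq> K"
    and start: "\<And>\<sigma>. \<sigma> \<in> {0..1} \<Longrightarrow> k (pathstart w, \<sigma>) = y"
    and bottom: "\<And>v. v \<in> K \<Longrightarrow> k (v, 0) = y"
  shows "homotopic_paths S (\<lambda>t. k (w t, 1)) (\<lambda>t. k (pathfinish w, t))"
proof -
  have wK: "w t \<in> K" if "t \<in> {0..1}" for t
    using w(2) that by (auto simp: path_image_def)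
  have cw: "continuous_on {0..1} w"
    using w(1) by (simp add: path_def)
  have compose: "continuous_on ({0..1} \<times> {0..1}) (\<lambda>x. k (w (a x), b x))"
    if "continuous_on ({0..1} \<times> {0..1}) a" "continuous_on ({0..1} \<times> {0..1}) b"
      "a ` ({0..1} \<times> {0..1}) \<subseteq> {0..1}" "b ` ({0..1} \<times> {0..1}) \<subseteq> {0..1}"
    for a b :: "real \<times> real \<Rightarrow> real"
  proof -
    have "continuous_on ({0..1} \<times> {0..1}) (\<lambda>x. (w (a x), b x))"
      using that cw by (intro continuous_on_Pair continuous_on_compose2[OF cw]) auto
    moreover have "(\<lambda>x. (w (a x), b x)) ` ({0..1} \<times> {0..1}) \<subseteq> K \<times> {0..1}"
      using that wK by (simp add: image_subset_iff)
    ultimately show ?thesis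
      using continuous_on_compose2[OF k(1)] by blast
  qed
  have in_unit: "s + (1 - s) * t \<in> {0..1}" "1 - s + s * t \<in> {0..1}"
    if "s \<in> {0..1}" "t \<in> {0..1}" for s t :: real
  proof -
    have "0 \<le> s * t" "s * t \<le> s" "0 \<le> (1 - s) * t" "(1 - s) * t \<le> 1 - s"
      using that by (auto intro: mult_nonneg_nonneg mult_left_le)
    then show "s + (1 - s) * t \<in> {0..1}" "1 - s + s * t \<in> {0..1}"
      using that by auto
  qed
  have kS: "k (w a, b) \<in> S" if "a \<in> {0..1}" "b \<in> {0..1}" for a b
    using k(2) wK that by blast
  have w0: "w 0 = pathstart w" and w1: "w 1 = pathfinish w"
    by (simp_all add: pathstart_def pathfinish_def)
  have "homotopic_paths S (\<lambda>t. k (w t, 1)) (\<lambda>t. k (w t, t))"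
    unfolding homotopic_paths
  proof (intro exI conjI)
    let ?h = "\<lambda>x::real \<times> real. k (w (snd x), 1 - fst x + fst x * snd x)"
    show "continuous_on ({0..1} \<times> {0..1}) ?h"
      using in_unit by (intro compose continuous_intros) auto
    show "?h \<in> {0..1} \<times> {0..1} \<rightarrow> S"
      using in_unit kS by auto
  qed (use w0 start in \<open>auto simp: pathstart_def pathfinish_def\<close>)
  moreover have "homotopic_paths S (\<lambda>t. k (w t, t)) (\<lambda>t. k (pathfinish w, t))"
    unfolding homotopic_paths
  proof (intro exI conjI)
    let ?h = "\<lambda>x::real \<times> real. k (w (fst x + (1 - fst x) * snd x), snd x)"
    show "continuous_on ({0..1} \<times> {0..1}) ?h"
      using in_unit by (intro compose continuous_intros) auto
    show "?h \<in> {0..1} \<times> {0..1} \<rightarrow> S"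
      using in_unit kS by auto
  qed (use w0 w1 wK bottom in \<open>auto simp: pathstart_def pathfinish_def\<close>)
  ultimately show ?thesis
    by (rule homotopic_paths_trans)
qed

text \<open>The set in question collects the points whose whole fibre lies in \<open>V\<close>; it
  is open because \<open>q\<close> is a closed map on the compact set \<open>D\<close>.\<close>

lemma (in convex_quotient) fibre_neighbourhood:
  assumes "compact D" "open V" "\<And>z. z \<in> D \<Longrightarrow> q z = y \<Longrightarrow> z \<in> V" "y \<in> S"
  shows "openin (top_of_set S) (S - q ` (D - V))" "y \<in> S - q ` (D - V)"
    "S - q ` (D - V) \<subseteq> q ` (D \<inter> V)"
proof -
  have "compact (D - V)"
    using assms by (simp add: compact_diff)
  then have "closed (q ` (D - V))"
    using cont by (meson Diff_subset compact_continuous_image compact_imp_closed continuous_on_subset)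
  then show "openin (top_of_set S) (S - q ` (D - V))"
    by (simp add: Diff_eq openin_open_Int open_Compl)
  show "y \<in> S - q ` (D - V)"
    using assms(3,4) by blast
  show "S - q ` (D - V) \<subseteq> q ` (D \<inter> V)"
    using img by auto
qed

section \<open>The boundary circle and the equivalence relation of the gluing\<close>

lemma norm_polygon_point [simp]: "norm (polygon_point g s) = 1"
  by (simp add: polygon_point_def)

lemma polygon_point_eq_iff:
  assumes "1 \<le> g"
  shows "polygon_point g s = polygon_point g t \<longleftrightarrow> (\<exists>n::int. s = t + 4 * real g * of_int n)"
proof -
  have g: "4 * real g \<noteq> 0"
    using assms by simp
  have "2 * pi * s / (4 * real g) = 2 * pi * t / (4 * real g) + 2 * pi * of_int n \<longleftrightarrow>
     s = t + 4 * real g * of_int n" for n :: int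
  proof -
    have "2 * pi * t / (4 * real g) + 2 * pi * of_int n = 2 * pi * (t + 4 * real g * of_int n) / (4 * real g)"
      using g by (simp add: field_simps)
    then have "2 * pi * s / (4 * real g) = 2 * pi * t / (4 * real g) + 2 * pi * of_int n \<longleftrightarrow>
        2 * pi * s = 2 * pi * (t + 4 * real g * of_int n)"
      using g by (simp only: divide_cancel_right) simp
    then show ?thesis
      by simp
  qed
  then show ?thesis
    unfolding polygon_point_def cis_conv_exp exp_eq by (simp add: complex_eq_iff algebra_simps)
qed

lemma polygon_point_add:
  "polygon_point g (s + t) = polygon_point g s * polygon_point g t"
  unfolding polygon_point_def cis_mult by (rule arg_cong[of _ _ cis]) (simp only: distrib_left add_divide_distrib)

lemma continuous_on_polygon_point [continuous_intros]:
  "continuous_on A f \<Longrightarrow> continuous_on A (\<lambda>x. polygon_point g (f x))"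
  unfolding polygon_point_def cis_conv_exp divide_inverse
  by (intro continuous_on_exp continuous_on_mult continuous_on_of_real continuous_on_const)

text \<open>The boundary parameter glued to \<open>s\<close>, for \<open>s\<close> in the interior of an edge.\<close>

definition mate :: "real \<Rightarrow> real" where
  "mate s = of_int (8 * (\<lfloor>s\<rfloor> div 4) + (if even \<lfloor>s\<rfloor> then 3 else 5)) - s"

lemma mate_in_Ints_iff [simp]: "mate s \<in> \<int> \<longleftrightarrow> s \<in> \<int>"
proof -
  obtain n :: int where n: "mate s = of_int n - s"
    unfolding mate_def by blast
  then have "s = of_int n - mate s"
    by simp
  with n show ?thesis
    by (metis Ints_diff Ints_of_int)
qed

lemma mate_shift: "mate (s + 4 * of_int n) = mate s + 4 * of_int n"
proof -
  have "\<lfloor>s + 4 * of_int n\<rfloor> = \<lfloor>s\<rfloor> + 4 * n"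
    by (metis floor_add_int of_int_mult of_int_numeral)
  then show ?thesis
    by (simp add: mate_def)
qed

text \<open>Glued parameters have sum \<open>8 * j + 3\<close> on the sides \<open>4 * j\<close> and
  \<open>4 * j + 2\<close>, and \<open>8 * j + 5\<close> on the other two of the block. Reflection
  reverses the side, so the floor is the sum minus the floor of \<open>s\<close> minus one, which
  turns 3 and 5 into 2 and 4; this last one is lost at integers.\<close>

lemma floor_mate:
  assumes "s \<notin> \<int>"
  shows "\<lfloor>mate s\<rfloor> = 8 * (\<lfloor>s\<rfloor> div 4) + (if even \<lfloor>s\<rfloor> then 2 else 4) - \<lfloor>s\<rfloor>"
proof -
  have "of_int \<lfloor>s\<rfloor> < s"
    using assms by (metis Ints_of_int le_less of_int_floor_le)
  moreover have "s < of_int \<lfloor>s\<rfloor> + 1"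
    by linarith
  ultimately show ?thesis
    unfolding mate_def by (intro floor_unique) (simp_all, linarith+)
qed

lemma mate_mate:
  assumes "s \<notin> \<int>"
  shows "mate (mate s) = s"
proof -
  define k where "k = \<lfloor>s\<rfloor>"
  define l where "l = \<lfloor>mate s\<rfloor>"
  have l: "l = 8 * (k div 4) + (if even k then 2 else 4) - k"
    using floor_mate[OF assms] by (simp add: l_def k_def)
  have "8 * (l div 4) + (if even l then 3 else 5) = 8 * (k div 4) + (if even k then 3 else (5::int))"
  proof -
    define j where "j = k div 4"
    have "k = 4 * j \<or> k = 4 * j + 1 \<or> k = 4 * j + 2 \<or> k = 4 * j + 3"
      unfolding j_def by presburger
    then have "l = 4 * j \<and> k = 4 * j + 2 \<or> l = 4 * j + 1 \<and> k = 4 * j + 3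
        \<or> l = 4 * j + 2 \<and> k = 4 * j \<or> l = 4 * j + 3 \<and> k = 4 * j + 1"
      unfolding l by auto
    then show ?thesis
      by auto
  qed
  then show ?thesis
    by (simp add: mate_def[of "mate s"] flip: l_def) (simp add: mate_def flip: k_def)
qed

text \<open>Glued sides are two apart in their block of four, hence different modulo 4 and also
  modulo the number \<open>4 * g\<close> of sides. A point inside a side is therefore never glued to
  a point of the same side, which keeps the two sectors in \<open>edge_liftable\<close>
  apart.\<close>

lemma floor_mate_neq:
  assumes "s \<notin> \<int>"
  shows "\<lfloor>mate s\<rfloor> \<noteq> \<lfloor>s\<rfloor> + 4 * n"
proof -
  define k j where "k = \<lfloor>s\<rfloor>" and "j = k div 4"
  have "k = 4 * j \<or> k = 4 * j + 1 \<or> k = 4 * j + 2 \<or> k = 4 * j + 3"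
    unfolding j_def by presburger
  then have "\<lfloor>mate s\<rfloor> = k + 2 \<or> \<lfloor>mate s\<rfloor> = k - 2"
    unfolding floor_mate[OF assms] k_def[symmetric] by auto
  then show ?thesis
    unfolding k_def[symmetric] by presburger
qed

lemma mate_affine:
  assumes "\<lfloor>c + a\<rfloor> = \<lfloor>c + b\<rfloor>"
  shows "mate (c + a) = mate (c + b) + b - a"
  using assms by (simp add: mate_def)

text \<open>The relation is defined for blocks \<open>j < g\<close>. Since
  \<open>polygon_point g\<close> has period \<open>4 * g\<close>, reducing \<open>j\<close> modulo
  \<open>g\<close> extends it to all integers, and later parameters may be any real numbers.\<close>

lemma equivclp_edge_gluing:
  assumes g: "1 \<le> g" and t: "t \<in> {0..1}"
  shows "equivclp (edge_gluing g) (polygon_point g (4 * of_int j + t)) (polygon_point g (4 * of_int j + 3 - t))"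
    and "equivclp (edge_gluing g) (polygon_point g (4 * of_int j + 1 + t)) (polygon_point g (4 * of_int j + 4 - t))"
proof -
  define k where "k = nat (j mod int g)"
  have k: "k < g" "int k = j mod int g"
    using g by (auto simp: k_def nat_less_iff)
  have "j = int k + int g * (j div int g)"
    using k(2) by simp
  then have j: "real_of_int j = real k + real g * of_int (j div int g)"
    by (metis of_int_add of_int_mult of_int_of_nat_eq)
  have shift: "polygon_point g (4 * of_int j + a) = polygon_point g (4 * real k + a)" for a
    unfolding polygon_point_eq_iff[OF g] by (rule exI[of _ "j div int g"]) (subst j, simp add: algebra_simps)
  have "edge_gluing g (polygon_point g (4 * real k + t)) (polygon_point g (4 * real k + 3 - t))"
    and "edge_gluing g (polygon_point g (4 * real k + 1 + t)) (polygon_point g (4 * real k + 4 - t))"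
    using k(1) t unfolding edge_gluing_def by blast+
  then show "equivclp (edge_gluing g) (polygon_point g (4 * of_int j + t)) (polygon_point g (4 * of_int j + 3 - t))"
    and "equivclp (edge_gluing g) (polygon_point g (4 * of_int j + 1 + t)) (polygon_point g (4 * of_int j + 4 - t))"
    using shift[of t] shift[of "3 - t"] shift[of "1 + t"] shift[of "4 - t"]
    by (simp_all add: add_diff_eq add.assoc r_into_equivclp)
qed

lemma equivclp_mate:
  assumes g: "1 \<le> g"
  shows "equivclp (edge_gluing g) (polygon_point g s) (polygon_point g (mate s))"
proof -
  define k where "k = \<lfloor>s\<rfloor>"
  define j where "j = k div 4"
  have s: "of_int k \<le> s" "s < of_int k + 1"
    unfolding k_def by linarith+
  have m: "mate s = of_int (8 * j + (if even k then 3 else 5)) - s"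
    by (simp add: mate_def k_def j_def)
  have "k = 4 * j \<or> k = 4 * j + 1 \<or> k = 4 * j + 2 \<or> k = 4 * j + 3"
    unfolding j_def by presburger
  then show ?thesis
  proof (elim disjE)
    assume k: "k = 4 * j"
    have "mate s = 4 * of_int j + 3 - (s - 4 * of_int j)" "s = 4 * of_int j + (s - 4 * of_int j)"
      using m k by simp_all
    then show ?thesis
      using equivclp_edge_gluing(1)[OF g, of "s - 4 * of_int j" j] s k by simp
  next
    assume k: "k = 4 * j + 1"
    have "mate s = 4 * of_int j + 4 - (s - 4 * of_int j - 1)" "s = 4 * of_int j + 1 + (s - 4 * of_int j - 1)"
      using m k by simp_all
    then show ?thesis
      using equivclp_edge_gluing(2)[OF g, of "s - 4 * of_int j - 1" j] s k by simp
  next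
    assume k: "k = 4 * j + 2"
    have "mate s = 4 * of_int j + (4 * of_int j + 3 - s)" "s = 4 * of_int j + 3 - (4 * of_int j + 3 - s)"
      using m k by simp_all
    then show ?thesis
      using equivclp_edge_gluing(1)[OF g, of "4 * of_int j + 3 - s" j] s k by - (rule equivclp_sym, simp)
  next
    assume k: "k = 4 * j + 3"
    have "mate s = 4 * of_int j + 1 + (4 * of_int j + 4 - s)" "s = 4 * of_int j + 4 - (4 * of_int j + 4 - s)"
      using m k by simp_all
    then show ?thesis
      using equivclp_edge_gluing(2)[OF g, of "4 * of_int j + 4 - s" j] s k by - (rule equivclp_sym, simp)
  qed
qed

text \<open>The gluings at the ends of the sides link the vertices in the order
  \<open>4 * j\<close>, \<open>4 * j + 3\<close>, \<open>4 * j + 2\<close>,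
  \<open>4 * j + 1\<close>, \<open>4 * j + 4\<close>, so every block is joined to the next.\<close>

lemma equivclp_vertices:
  assumes g: "1 \<le> g"
  shows "equivclp (edge_gluing g) (polygon_point g (of_int a)) (polygon_point g (of_int b))"
proof -
  let ?E = "\<lambda>a b. equivclp (edge_gluing g) (polygon_point g a) (polygon_point g b)"
  have next_vertex: "?E (of_int k) (of_int (k + 1))" for k
  proof -
    define j where "j = k div 4"
    have 1: "?E (4 * of_int j) (4 * of_int j + 3)" "?E (4 * of_int j + 1) (4 * of_int j + 2)"
      "?E (4 * of_int j + 1) (4 * of_int j + 4)" "?E (4 * of_int j + 2) (4 * of_int j + 3)"
      using equivclp_edge_gluing(1)[OF g, of 0 j] equivclp_edge_gluing(1)[OF g, of 1 j]
        equivclp_edge_gluing(2)[OF g, of 0 j] equivclp_edge_gluing(2)[OF g, of 1 j]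
      by (simp_all add: add.assoc diff_conv_add_uminus del: add_uminus_conv_diff)
    then have "?E (4 * of_int j) (4 * of_int j + 1)" "?E (4 * of_int j + 3) (4 * of_int j + 4)"
      by (meson equivclp_sym equivclp_trans)+
    moreover have "k = 4 * j \<or> k = 4 * j + 1 \<or> k = 4 * j + 2 \<or> k = 4 * j + 3"
      unfolding j_def by presburger
    ultimately show ?thesis
      using 1 by (elim disjE) (simp_all add: add.assoc)
  qed
  have "?E 0 (of_int a)" for a :: int
  proof (induction a rule: int_induct[where k=0])
    case base
    then show ?case by simp
  next
    case (step1 i)
    then show ?case
      using next_vertex[of i] equivclp_trans by meson
  next
    case (step2 i)
    then show ?case
      using next_vertex[of "i - 1"] equivclp_trans equivclp_sym by (metis diff_add_cancel)
  qed
  then show ?thesis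
    by (meson equivclp_sym equivclp_trans)
qed

text \<open>Closed form of the equivalence closure of \<open>edge_gluing\<close>: the classes are
  single points inside the disc, pairs inside the sides, and one class of all vertices. Constructing
  neighbourhoods in the surface requires whole fibres of \<open>q\<close>, which the generated
  relation does not display.\<close>

definition glued :: "nat \<Rightarrow> complex \<Rightarrow> complex \<Rightarrow> bool" where
  "glued g z w \<longleftrightarrow> z = w \<or> (\<exists>s. s \<notin> \<int> \<and> z = polygon_point g s \<and> w = polygon_point g (mate s)) \<or>
     (\<exists>a b::int. z = polygon_point g (of_int a) \<and> w = polygon_point g (of_int b))"

lemma polygon_point_noninteger:
  assumes "1 \<le> g" "polygon_point g s = polygon_point g t"
  shows "s \<in> \<int> \<longleftrightarrow> t \<in> \<int>"
proof -
  obtain n where s: "s = t + 4 * real g * of_int n"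
    using assms polygon_point_eq_iff by auto
  have "4 * real g * of_int n \<in> \<int>"
    by (simp add: Ints_mult)
  then show ?thesis
    unfolding s by (metis Ints_add Ints_diff add_diff_cancel_right')
qed

text \<open>The parameter of a boundary point is determined only up to multiples of
  \<open>4 * g\<close>; \<open>mate\<close> commutes with such shifts and so acts on the
  circle.\<close>

lemma polygon_point_mate_cong:
  assumes "1 \<le> g" "polygon_point g s = polygon_point g t"
  shows "polygon_point g (mate s) = polygon_point g (mate t)"
proof -
  obtain n where s: "s = t + 4 * real g * of_int n"
    using assms polygon_point_eq_iff by auto
  then have "mate s = mate t + 4 * real g * of_int n"
    using mate_shift[of t "int g * n"] by (simp add: mult.assoc)
  then show ?thesis
    using assms(1) polygon_point_eq_iff by blast
qed

lemma glued_sym: "glued g z w \<Longrightarrow> glued g w z"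
  unfolding glued_def
proof (elim disjE exE conjE)
  fix s assume "s \<notin> \<int>" "z = polygon_point g s" "w = polygon_point g (mate s)"
  then have "mate s \<notin> \<int> \<and> w = polygon_point g (mate s) \<and> z = polygon_point g (mate (mate s))"
    by (simp add: mate_mate)
  then show "w = z \<or> (\<exists>s. s \<notin> \<int> \<and> w = polygon_point g s \<and> z = polygon_point g (mate s)) \<or>
     (\<exists>a b::int. w = polygon_point g (of_int a) \<and> z = polygon_point g (of_int b))"
    by blast
qed blast+

text \<open>Two side gluings in a row cancel because \<open>mate\<close> is an involution, two
  vertex gluings merge into one, and the two kinds never meet because integrality of the parameter
  depends on the point alone.\<close>

lemma glued_trans:
  assumes g: "1 \<le> g" and "glued g z w" "glued g w v"
  shows "glued g z v"
proof -
  consider "z = w" | s where "s \<notin> \<int>" "z = polygon_point g s" "w = polygon_point g (mate s)"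
    | a b :: int where "z = polygon_point g (of_int a)" "w = polygon_point g (of_int b)"
    using assms(2) unfolding glued_def by blast
  then show ?thesis
  proof cases
    case 1
    then show ?thesis using assms(3) by simp
  next
    case (2 s)
    consider "w = v" | t where "t \<notin> \<int>" "w = polygon_point g t" "v = polygon_point g (mate t)"
      | a :: int where "w = polygon_point g (of_int a)"
      using assms(3) unfolding glued_def by blast
    then show ?thesis
    proof cases
      case 1
      then show ?thesis using assms(2) by simp
    next
      case (2 t)
      then have "v = polygon_point g (mate (mate s))"
        using polygon_point_mate_cong[OF g, of "mate s" t] \<open>w = polygon_point g (mate s)\<close> by simp
      then show ?thesis
        using \<open>s \<notin> \<int>\<close> \<open>z = polygon_point g s\<close> by (simp add: mate_mate glued_def)
    next
      case (3 a)
      then show ?thesis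
        using polygon_point_noninteger[OF g, of "mate s" "of_int a"] 2 by simp
    qed
  next
    case (3 a b)
    consider "w = v" | t where "t \<notin> \<int>" "w = polygon_point g t"
      | d :: int where "v = polygon_point g (of_int d)"
      using assms(3) unfolding glued_def by blast
    then show ?thesis
    proof cases
      case 1
      then show ?thesis using assms(2) by simp
    next
      case (2 t)
      then show ?thesis
        using polygon_point_noninteger[OF g, of t "of_int b"] \<open>w = polygon_point g (of_int b)\<close> by simp
    next
      case (3 d)
      then show ?thesis
        using \<open>z = polygon_point g (of_int a)\<close> unfolding glued_def by blast
    qed
  qed
qed

lemma edge_gluing_imp_glued:
  assumes "edge_gluing g z w"
  shows "glued g z w"
proof -
  obtain j t where t: "t \<in> {0..1::real}" and "(z = polygon_point g (4 * real j + t) \<and> w = polygon_point g (4 * real j + 3 - t)) \<or>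
     (z = polygon_point g (4 * real j + 1 + t) \<and> w = polygon_point g (4 * real j + 4 - t))"
    using assms unfolding edge_gluing_def by blast
  \<comment> \<open>Both families of gluings take the form \<open>4 * j + e + t\<close> against
    \<open>4 * j + e + 3 - t\<close>.\<close>
  then obtain e :: int where e: "e \<in> {0, 1}" and z: "z = polygon_point g (4 * real j + of_int e + t)"
    and w: "w = polygon_point g (4 * real j + of_int e + 3 - t)"
    by (elim disjE) (force simp: add.assoc)+
  show ?thesis
  proof (cases "t = 0 \<or> t = 1")
    case True
    then have "z = polygon_point g (of_int (4 * int j + e + (if t = 0 then 0 else 1)))"
      "w = polygon_point g (of_int (4 * int j + e + 3 - (if t = 0 then 0 else 1)))"
      using z w by (auto simp: algebra_simps)
    then show ?thesis
      unfolding glued_def by blast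
  next
    case False
    let ?s = "4 * real j + of_int e + t"
    have fl: "\<lfloor>?s\<rfloor> = 4 * int j + e"
      using False t by (intro floor_unique) auto
    have "?s \<notin> \<int>"
    proof
      assume "?s \<in> \<int>"
      then have "of_int \<lfloor>?s\<rfloor> = ?s"
        by (metis Ints_cases floor_of_int)
      then show False
        using False unfolding fl by simp
    qed
    moreover have "mate ?s = 4 * real j + of_int e + 3 - t"
    proof -
      have "8 * ((4 * int j + e) div 4) + (if even (4 * int j + e) then 3 else 5) = 2 * (4 * int j + e) + 3"
        using e by auto
      then show ?thesis
        unfolding mate_def fl by simp
    qed
    ultimately have "\<exists>s. s \<notin> \<int> \<and> z = polygon_point g s \<and> w = polygon_point g (mate s)"
      using z w by (intro exI[of _ ?s]) simp
    then show ?thesis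
      unfolding glued_def by blast
  qed
qed

lemma equivclp_edge_gluing_iff:
  assumes "1 \<le> g"
  shows "equivclp (edge_gluing g) z w \<longleftrightarrow> glued g z w"
proof
  assume "equivclp (edge_gluing g) z w"
  then show "glued g z w"
  proof (induction rule: equivclp_induct)
    case base
    then show ?case by (simp add: glued_def)
  next
    case (step y w)
    then show ?case
      using edge_gluing_imp_glued glued_sym glued_trans[OF assms] by meson
  qed
next
  assume "glued g z w"
  then show "equivclp (edge_gluing g) z w"
    using equivclp_mate[OF assms] equivclp_vertices[OF assms] by (auto simp: glued_def)
qed

lemma glued_norm:
  assumes "glued g z w" "z \<noteq> w"
  shows "norm z = 1" "norm w = 1"
  using assms unfolding glued_def by auto

text \<open>Division by \<open>polygon_point g c\<close> rotates the situation to the point 1, where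
  \<open>Arg\<close> is continuous; so \<eta> does not depend on \<open>c\<close>. The bound 1/2 on
  \<eta> keeps the points at norm at least 1/2, away from the centre of the polar
  coordinates.\<close>

lemma near_polygon_point:
  assumes g: "1 \<le> g" and \<delta>: "0 < \<delta>"
  obtains \<eta> where "0 < \<eta>" "\<eta> \<le> 1/2"
    "\<And>z c. norm (z - polygon_point g c) < \<eta> \<Longrightarrow>
      \<exists>\<tau>. \<bar>\<tau>\<bar> \<le> \<delta> \<and> z = of_real (norm z) * polygon_point g (c + \<tau>)"
proof -
  define \<epsilon> where "\<epsilon> = 2 * pi * \<delta> / (4 * real g)"
  have \<epsilon>: "\<epsilon> > 0"
    using g \<delta> by (simp add: \<epsilon>_def)
  have "isCont Arg 1"
    by (intro continuous_at_Arg) auto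
  then have "\<exists>d>0. \<forall>w. dist w 1 < d \<longrightarrow> dist (Arg w) (Arg 1) < \<epsilon>"
    using \<epsilon> unfolding continuous_at_eps_delta by blast
  then obtain d where d: "d > 0" "\<And>w. norm (w - 1) < d \<Longrightarrow> \<bar>Arg w\<bar> < \<epsilon>"
    by (auto simp: dist_norm)
  show thesis
  proof (rule that[of "min d (1/2)"])
    fix z c assume z: "norm (z - polygon_point g c) < min d (1/2)"
    define w where "w = z / polygon_point g c"
    have nz: "polygon_point g c \<noteq> 0"
      using norm_polygon_point[of g c] by force
    have zw: "z = w * polygon_point g c"
      using nz by (simp add: w_def)
    have nw: "norm z = norm w"
      unfolding zw by (simp add: norm_mult)
    have "z - polygon_point g c = (w - 1) * polygon_point g c"
      unfolding zw by (simp add: algebra_simps)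
    then have "norm (w - 1) = norm (z - polygon_point g c)"
      by (simp add: norm_mult)
    then have arg: "\<bar>Arg w\<bar> < \<epsilon>"
      using z by (intro d(2)) simp
    define \<tau> where "\<tau> = Arg w * (4 * real g) / (2 * pi)"
    have "2 * pi * \<tau> / (4 * real g) = Arg w"
      using g by (simp add: \<tau>_def)
    then have "polygon_point g \<tau> = cis (Arg w)"
      by (simp add: polygon_point_def)
    then have "w = of_real (norm w) * polygon_point g \<tau>"
      using rcis_cmod_Arg[of w] by (simp add: rcis_def)
    then have "z = of_real (norm z) * polygon_point g (c + \<tau>)"
      unfolding polygon_point_add nw by (subst zw) (simp add: mult.assoc mult.commute)
    moreover have "\<bar>\<tau>\<bar> \<le> \<delta>"
    proof -
      have "\<bar>\<tau>\<bar> = \<bar>Arg w\<bar> * (4 * real g) / (2 * pi)"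
        by (simp add: \<tau>_def abs_mult)
      also have "\<dots> \<le> \<epsilon> * (4 * real g) / (2 * pi)"
        using arg by (intro divide_right_mono mult_right_mono) auto
      also have "\<dots> = \<delta>"
        using g by (simp add: \<epsilon>_def)
      finally show ?thesis .
    qed
    ultimately show "\<exists>\<tau>. \<bar>\<tau>\<bar> \<le> \<delta> \<and> z = of_real (norm z) * polygon_point g (c + \<tau>)"
      by blast
  qed (use d in auto)
qed

section \<open>Local contractibility of the glued surface\<close>

locale glued_polygon = convex_quotient "cball 0 1 :: complex set" S q z0
  for S :: "'a::real_normed_vector set" and q z0 +
  fixes g :: nat
  assumes genus_pos: "1 \<le> g"
    and q_eq_iff: "\<And>z w. z \<in> cball 0 1 \<Longrightarrow> w \<in> cball 0 1 \<Longrightarrow> q z = q w \<longleftrightarrow> glued g z w"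
begin

lemma q_polygon_point_eq_iff:
  "q (polygon_point g s) = q (polygon_point g t) \<longleftrightarrow> glued g (polygon_point g s) (polygon_point g t)"
  by (rule q_eq_iff) simp_all

text \<open>Points of the open disc are glued to no other point, so \<open>q\<close> has a
  continuous inverse on the image of a smaller closed disc, and composing with it lifts paths
  exactly.\<close>

lemma interior_liftable:
  assumes z: "norm z < 1"
  shows "locally_liftable (q z)"
proof -
  define r where "r = (1 + norm z) / 2"
  have r: "norm z < r" "r < 1"
    using z by (auto simp: r_def)
  have only: "w = v" if "w \<in> cball 0 1" "q w = q v" "norm v < 1" for v w
    using that glued_norm[of g w v] q_eq_iff[of w v] by fastforce
  have inj: "inj_on q (cball 0 r)"
    using r(2) only by (intro inj_onI) auto
  have contr: "continuous_on (cball 0 r) q"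
    using r(2) cont by (intro continuous_on_subset[OF cont]) auto
  obtain k where k: "continuous_on (q ` cball 0 r) k" "\<And>v. v \<in> cball 0 r \<Longrightarrow> k (q v) = v"
    using continuous_factor_through_compact[OF compact_cball contr continuous_on_id]
      inj_onD[OF inj] by blast
  have qz: "q z \<in> S"
    using z img by auto
  have fibre: "w \<in> ball 0 r" if "w \<in> cball 0 1" "q w = q z" for w
    using only[OF that z] r by simp
  define U where "U = S - q ` (cball 0 1 - ball 0 r)"
  note U = fibre_neighbourhood[OF compact_cball open_ball fibre qz, folded U_def]
  have Uk: "U \<subseteq> q ` cball 0 r"
    using U(3) by auto
  have "\<exists>u. path u \<and> path_image u \<subseteq> cball 0 1 \<and> homotopic_paths S w (q \<circ> u)"
    if w: "path w" "path_image w \<subseteq> U" for w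
  proof (intro exI conjI)
    show "path (k \<circ> w)"
      using w k(1) Uk by (intro path_continuous_image continuous_on_subset[OF k(1)]) auto
    have kq: "k y \<in> cball 0 r \<and> q (k y) = y" if "y \<in> U" for y
      using that Uk k(2) by auto
    show "path_image (k \<circ> w) \<subseteq> cball 0 1"
    proof -
      have "k y \<in> cball 0 1" if "y \<in> U" for y
        using kq[OF that] r(2) by simp
      then show ?thesis
        unfolding path_image_compose using w(2) by blast
    qed
    show "homotopic_paths S w (q \<circ> (k \<circ> w))"
    proof (rule homotopic_paths_eq[OF w(1)])
      show "path_image w \<subseteq> S"
        using w(2) by (auto simp: U_def)
      show "w t = (q \<circ> (k \<circ> w)) t" if "t \<in> {0..1}" for t
      proof -
        have "w t \<in> U"
          using w(2) that by (auto simp: path_image_def)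
        then show ?thesis
          using kq by simp
      qed
    qed
  qed
  then show ?thesis
    unfolding locally_liftable_def using U(1,2) by blast
qed

text \<open>The contraction is linear in polar coordinates around each preimage \<open>polygon_point g c\<close>
  of the given point. Because the gluing preserves arc length, it descends to the surface.\<close>

lemma boundary_liftable:
  assumes "finite I" and \<delta>: "0 < \<delta>"
    and centre: "\<And>c. c \<in> I \<Longrightarrow> q (polygon_point g c) = y"
    and fibre: "\<And>z. z \<in> cball 0 1 \<Longrightarrow> q z = y \<Longrightarrow> z \<in> polygon_point g ` I"
    and sep: "\<And>c c' \<tau> \<tau>'. c \<in> I \<Longrightarrow> c' \<in> I \<Longrightarrow> \<bar>\<tau>\<bar> \<le> \<delta> \<Longrightarrow> \<bar>\<tau>'\<bar> \<le> \<delta> \<Longrightarrow>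
      polygon_point g (c + \<tau>) = polygon_point g (c' + \<tau>') \<Longrightarrow> c = c' \<and> \<tau> = \<tau>'"
    and scale: "\<And>c c' \<tau> \<tau>' \<mu>. c \<in> I \<Longrightarrow> c' \<in> I \<Longrightarrow> \<bar>\<tau>\<bar> \<le> \<delta> \<Longrightarrow> \<bar>\<tau>'\<bar> \<le> \<delta> \<Longrightarrow> \<mu> \<in> {0..1} \<Longrightarrow>
      q (polygon_point g (c + \<tau>)) = q (polygon_point g (c' + \<tau>')) \<Longrightarrow>
      q (polygon_point g (c + \<mu> * \<tau>)) = q (polygon_point g (c' + \<mu> * \<tau>'))"
    and y: "y \<in> S"
  shows "locally_liftable y"
proof -
  obtain \<eta> where \<eta>: "0 < \<eta>" "\<eta> \<le> 1/2"
    and near: "\<And>z c. norm (z - polygon_point g c) < \<eta> \<Longrightarrow>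
      \<exists>\<tau>. \<bar>\<tau>\<bar> \<le> \<delta> \<and> z = of_real (norm z) * polygon_point g (c + \<tau>)"
    using near_polygon_point[OF genus_pos \<delta>] by blast
  \<comment> \<open>\<open>C\<close> is a disjoint union of sectors in polar coordinates, one for
    each preimage of \<open>y\<close>: \<rho> is the radius and \<tau> the deviation of the
    parameter from \<open>c\<close>.\<close>
  define C where "C = I \<times> {1/2..1::real} \<times> {-\<delta>..\<delta>}"
  have comp: "compact C"
    unfolding C_def using \<open>finite I\<close> by (intro compact_Times finite_imp_compact compact_Icc)
  define f where "f = (\<lambda>(c, \<rho>, \<tau>). complex_of_real \<rho> * polygon_point g (c + \<tau>))"
  \<comment> \<open>At \<sigma> = 1 this is the identity and at \<sigma> = 0 it is the centre
    \<open>(c, 1, 0)\<close>. The condition \<rho> = 1 is preserved, so boundary points stay on the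
    boundary.\<close>
  define R where "R = (\<lambda>((c::real, \<rho>::real, \<tau>::real), \<sigma>::real). (c, 1 - \<sigma> * (1 - \<rho>), \<sigma> * \<tau>))"
  have R_C: "R (\<xi>, \<sigma>) \<in> C" if "\<xi> \<in> C" "\<sigma> \<in> {0..1}" for \<xi> :: "real \<times> real \<times> real" and \<sigma> :: real
  proof -
    obtain c \<rho> \<tau> where \<xi>: "\<xi> = (c, \<rho>, \<tau>)"
      by (cases \<xi>)
    have *: "c \<in> I" "1/2 \<le> \<rho>" "\<rho> \<le> 1" "\<bar>\<tau>\<bar> \<le> \<delta>" "0 \<le> \<sigma>" "\<sigma> \<le> 1"
      using that by (auto simp: C_def \<xi>)
    have "\<sigma> * (1 - \<rho>) \<le> 1 * (1 - \<rho>)" "0 \<le> \<sigma> * (1 - \<rho>)"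
      using * by (intro mult_right_mono mult_nonneg_nonneg; simp)+
    moreover have "\<bar>\<sigma> * \<tau>\<bar> \<le> 1 * \<delta>"
      unfolding abs_mult using * by (intro mult_mono) auto
    ultimately show ?thesis
      using * by (auto simp: R_def \<xi> C_def)
  qed
  have f_norm: "norm (f (c, \<rho>, \<tau>)) = \<bar>\<rho>\<bar>" for c \<rho> \<tau>
    by (simp add: f_def norm_mult)
  have f_D: "f \<xi> \<in> cball 0 1" if "\<xi> \<in> C" for \<xi>
    using that f_norm by (auto simp: C_def)
  have cont_f: "continuous_on C f"
    unfolding f_def case_prod_unfold by (intro continuous_intros)
  have cont_R: "continuous_on (C \<times> {0..1}) R"
    unfolding R_def case_prod_unfold by (intro continuous_intros)
  have cont_qf: "continuous_on C (\<lambda>\<xi>. q (f \<xi>))"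
    using cont_f f_D by (intro continuous_on_compose2[OF cont]) auto
  have cont_h: "continuous_on (C \<times> {0..1}) (\<lambda>x. q (f (R x)))"
    using cont_R R_C by (intro continuous_on_compose2[OF cont_qf]) auto
  have cont_M: "continuous_on (C \<times> {0..1}) (\<lambda>x::(real \<times> real \<times> real) \<times> real. (q (f (fst x)), snd x))"
    by (intro continuous_intros continuous_on_compose2[OF cont_qf]) auto
  \<comment> \<open>Equal points of the disc have equal coordinates by \<open>sep\<close>. Distinct
    glued points both lie on the circle, where \<rho> = 1 is preserved and \<open>scale\<close>
    applies.\<close>
  have compat: "q (f (R (\<xi>, \<sigma>))) = q (f (R (\<xi>', \<sigma>)))"
    if in_C: "\<xi> \<in> C" "\<xi>' \<in> C" and \<sigma>: "\<sigma> \<in> {0..1}" and eq: "q (f \<xi>) = q (f \<xi>')" for \<xi> \<xi>' \<sigma>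
  proof -
    obtain c \<rho> \<tau> c' \<rho>' \<tau>' where \<xi>: "\<xi> = (c, \<rho>, \<tau>)" "\<xi>' = (c', \<rho>', \<tau>')"
      by (cases \<xi>, cases \<xi>') auto
    have *: "c \<in> I" "1/2 \<le> \<rho>" "\<rho> \<le> 1" "\<bar>\<tau>\<bar> \<le> \<delta>" "c' \<in> I" "1/2 \<le> \<rho>'" "\<rho>' \<le> 1" "\<bar>\<tau>'\<bar> \<le> \<delta>"
      using in_C by (auto simp: C_def \<xi>)
    have gl: "glued g (f \<xi>) (f \<xi>')"
      using eq q_eq_iff f_D in_C by blast
    show ?thesis
    proof (cases "f \<xi> = f \<xi>'")
      case True
      then have "\<rho> = \<rho>'"
        using f_norm[of c \<rho> \<tau>] f_norm[of c' \<rho>' \<tau>'] * \<xi> by simp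
      moreover from this have "polygon_point g (c + \<tau>) = polygon_point g (c' + \<tau>')"
        using True * by (simp add: f_def \<xi>)
      ultimately show ?thesis
        using sep[of c c' \<tau> \<tau>'] * \<xi> by simp
    next
      case False
      then have "\<rho> = 1" "\<rho>' = 1"
        using glued_norm[OF gl] f_norm * \<xi> by simp_all
      then show ?thesis
        using scale[of c c' \<tau> \<tau>' \<sigma>] * \<xi> \<sigma> eq by (simp add: f_def R_def)
    qed
  qed
  define M where "M = (\<lambda>x::(real \<times> real \<times> real) \<times> real. (q (f (fst x)), snd x))"
  have M_img: "M ` (C \<times> {0..1}) = (q \<circ> f) ` C \<times> {0..1}"
  proof -
    have "M = map_prod (q \<circ> f) id"
      by (auto simp: M_def fun_eq_iff)
    then show ?thesis
      by (simp add: map_prod_surj_on)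
  qed
  have compat': "q (f (R x)) = q (f (R x'))"
    if "x \<in> C \<times> {0..1}" "x' \<in> C \<times> {0..1}" "M x = M x'" for x x'
  proof -
    have "snd x' = snd x"
      using that(3) by (simp add: M_def)
    moreover have "q (f (R (fst x, snd x))) = q (f (R (fst x', snd x)))"
      using that by (intro compat) (simp_all add: M_def mem_Times_iff)
    ultimately show ?thesis
      by (metis prod.collapse)
  qed
  \<comment> \<open>By \<open>compat\<close> the contraction of the coordinates is constant on the
    fibres of \<open>M\<close>, so it descends to a homotopy \<open>k\<close> on the image of the
    sectors in the surface.\<close>
  obtain k where k: "continuous_on (M ` (C \<times> {0..1})) k"
    and k_eq: "\<And>x. x \<in> C \<times> {0..1} \<Longrightarrow> k (M x) = q (f (R x))"
    using continuous_factor_through_compact[OF compact_Times[OF comp compact_Icc] cont_M[folded M_def] cont_h compat']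
    by blast
  have k_qf: "k (q (f \<xi>), \<sigma>) = q (f (R (\<xi>, \<sigma>)))" if "\<xi> \<in> C" "\<sigma> \<in> {0..1}" for \<xi> \<sigma>
    using k_eq[of "(\<xi>, \<sigma>)"] that by (simp add: M_def)
  let ?K = "(q \<circ> f) ` C"
  have k_cont: "continuous_on (?K \<times> {0..1}) k"
    using k unfolding M_img .
  have k_S: "k ` (?K \<times> {0..1}) \<subseteq> S"
  proof -
    have "k (q (f \<xi>), \<sigma>) \<in> S" if "\<xi> \<in> C" "\<sigma> \<in> {0..1}" for \<xi> \<sigma>
      unfolding k_qf[OF that] using img f_D[OF R_C[OF that]] by blast
    then show ?thesis by auto
  qed
  define V where "V = (\<Union>c\<in>I. ball (polygon_point g c) \<eta>)"
  have V: "open V"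
    by (auto simp: V_def)
  have fibre_V: "z \<in> V" if "z \<in> cball 0 1" "q z = y" for z
    using fibre[OF that] \<eta>(1) centre_in_ball unfolding V_def by blast
  define U where "U = S - q ` (cball 0 1 - V)"
  note U = fibre_neighbourhood[OF compact_cball V fibre_V y, folded U_def]
  have V_C: "cball 0 1 \<inter> V \<subseteq> f ` C"
  proof
    fix z assume "z \<in> cball 0 1 \<inter> V"
    then obtain c where c: "c \<in> I" "norm (z - polygon_point g c) < \<eta>" and z: "norm z \<le> 1"
      by (auto simp: V_def dist_norm norm_minus_commute)
    obtain \<tau> where \<tau>: "\<bar>\<tau>\<bar> \<le> \<delta>" "z = of_real (norm z) * polygon_point g (c + \<tau>)"
      using near[OF c(2)] by blast
    have "1/2 \<le> norm z"
      using norm_triangle_ineq3[of z "polygon_point g c"] c(2) \<eta>(2) by simp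
    then have "(c, norm z, \<tau>) \<in> C"
      using c z \<tau>(1) by (auto simp: C_def)
    moreover have "z = f (c, norm z, \<tau>)"
      using \<tau>(2) by (simp add: f_def)
    ultimately show "z \<in> f ` C"
      by blast
  qed
  then have U_K: "U \<subseteq> ?K"
    unfolding image_comp[symmetric] using U(3) by blast
  have "\<exists>u. path u \<and> path_image u \<subseteq> cball 0 1 \<and> homotopic_paths S w (q \<circ> u)"
    if w: "path w" "path_image w \<subseteq> U" "pathstart w = y" for w
  proof -
    have w_K: "path_image w \<subseteq> ?K"
      using w(2) U_K by blast
    then obtain \<xi> where \<xi>: "\<xi> \<in> C" "pathfinish w = q (f \<xi>)"
      using pathfinish_in_path_image[of w] by auto
    have top: "k (v, 1) = v" if "v \<in> ?K" for v
    proof -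
      from that obtain c \<rho> \<tau> where "(c, \<rho>, \<tau>) \<in> C" "v = q (f (c, \<rho>, \<tau>))"
        by auto
      then show ?thesis
        using k_qf[of "(c, \<rho>, \<tau>)" 1] by (simp add: R_def)
    qed
    have bottom: "k (v, 0) = y" if "v \<in> ?K" for v
    proof -
      from that obtain c \<rho> \<tau> where "(c, \<rho>, \<tau>) \<in> C" "v = q (f (c, \<rho>, \<tau>))"
        by auto
      then show ?thesis
        using k_qf[of "(c, \<rho>, \<tau>)" 0] centre[of c] by (simp add: R_def C_def) (simp add: f_def)
    qed
    have start: "k (pathstart w, \<sigma>) = y" if "\<sigma> \<in> {0..1}" for \<sigma>
    proof -
      obtain z where "z \<in> cball 0 1" "q z = y"
        using y img by auto
      then obtain c where c: "c \<in> I"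
        using fibre by blast
      then have "(c, 1, 0) \<in> C"
        using \<delta> by (auto simp: C_def)
      then show ?thesis
        using k_qf[of "(c, 1, 0)" \<sigma>] that centre[OF c] w(3) by (simp add: f_def R_def)
    qed
    have hom: "homotopic_paths S (\<lambda>t. k (w t, 1)) (\<lambda>t. k (pathfinish w, t))"
      by (rule contraction_homotopic_paths[OF k_cont k_S w(1) w_K start bottom])
    have top_w: "k (w t, 1) = w t" if "t \<in> {0..1}" for t
      using w_K that by (intro top) (auto simp: path_image_def)
    \<comment> \<open>The replacement of \<open>w\<close> runs in one sector from its centre to a
      preimage of the end of \<open>w\<close>; its image is the track of that end under the
      contraction.\<close>
    define u where "u = (\<lambda>\<sigma>. f (R (\<xi>, \<sigma>)))"
    have "continuous_on {0..1} (\<lambda>\<sigma>. R (\<xi>, \<sigma>))"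
      using \<xi>(1) by (intro continuous_on_compose2[OF cont_R] continuous_intros) auto
    then have "path u"
      unfolding path_def u_def using R_C[OF \<xi>(1)] by (intro continuous_on_compose2[OF cont_f]) blast+
    moreover have "path_image u \<subseteq> cball 0 1"
      unfolding u_def path_image_def using R_C[OF \<xi>(1)] f_D by blast
    moreover have "homotopic_paths S w (q \<circ> u)"
    proof -
      have wS: "path_image w \<subseteq> S"
        using w(2) by (auto simp: U_def)
      have "homotopic_paths S w (\<lambda>t. k (w t, 1))"
        using homotopic_paths_eq[OF w(1) wS] top_w by simp
      moreover have "homotopic_paths S (\<lambda>t. k (pathfinish w, t)) (q \<circ> u)"
      proof (rule homotopic_paths_eq)
        show "path (\<lambda>t. k (pathfinish w, t))" "path_image (\<lambda>t. k (pathfinish w, t)) \<subseteq> S"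
          using homotopic_paths_imp_path[OF hom] homotopic_paths_imp_subset[OF hom] by auto
        show "k (pathfinish w, t) = (q \<circ> u) t" if "t \<in> {0..1}" for t
          using k_qf[OF \<xi>(1) that] \<xi>(2) by (simp add: u_def)
      qed
      ultimately show ?thesis
        using hom by (meson homotopic_paths_trans)
    qed
    ultimately show ?thesis
      by blast
  qed
  then show ?thesis
    unfolding locally_liftable_def using U(1,2) by blast
qed

text \<open>The fibre consists of all \<open>4 * g\<close> vertices. Deviations of size at most 1/4
  differ by at most 1/2, less than the distance of two vertices, so a nearby boundary point
  determines both its vertex and its deviation.\<close>

lemma vertex_liftable: "locally_liftable (q (polygon_point g (of_int a)))"
proof (rule boundary_liftable[of "of_int ` {0..<4 * int g}" "1/4"])
  have reduce: "polygon_point g (of_int b) \<in> polygon_point g ` of_int ` {0..<4 * int g}" for b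
  proof -
    have "polygon_point g (of_int b) = polygon_point g (of_int (b mod (4 * int g)))"
      unfolding polygon_point_eq_iff[OF genus_pos]
    proof (rule exI[of _ "b div (4 * int g)"])
      have "b = b mod (4 * int g) + 4 * int g * (b div (4 * int g))"
        by simp
      then have "real_of_int b = of_int (b mod (4 * int g) + 4 * int g * (b div (4 * int g)))"
        by simp
      then show "real_of_int b = of_int (b mod (4 * int g)) + 4 * real g * of_int (b div (4 * int g))"
        by (simp only: of_int_add of_int_mult of_int_numeral of_int_of_nat_eq)
    qed
    then show ?thesis
      using genus_pos by (auto intro!: imageI)
  qed
  have vertices: "glued g (polygon_point g (of_int b)) (polygon_point g (of_int d))" for b d
    unfolding glued_def by blast
  show "q (polygon_point g c) = q (polygon_point g (of_int a))" if "c \<in> of_int ` {0..<4 * int g}" for c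
    using that vertices q_polygon_point_eq_iff by auto
  show "z \<in> polygon_point g ` of_int ` {0..<4 * int g}"
    if "z \<in> cball 0 1" "q z = q (polygon_point g (of_int a))" for z
  proof -
    have "glued g z (polygon_point g (of_int a))"
      using that q_eq_iff by simp
    then consider b where "z = polygon_point g (of_int b)"
      | s where "s \<notin> \<int>" "polygon_point g (of_int a) = polygon_point g (mate s)"
      unfolding glued_def by blast
    then show ?thesis
    proof cases
      case 2
      then show ?thesis
        using polygon_point_noninteger[OF genus_pos, of "of_int a" "mate s"] by simp
    qed (use reduce in simp)
  qed
  show "q (polygon_point g (of_int a)) \<in> S"
    using img by (auto intro!: imageI)
  fix c c' \<tau> \<tau>' :: real
  assume "c \<in> of_int ` {0..<4 * int g}" "c' \<in> of_int ` {0..<4 * int g}"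
    and \<tau>: "\<bar>\<tau>\<bar> \<le> 1/4" "\<bar>\<tau>'\<bar> \<le> 1/4"
  then obtain b b' where b: "c = of_int b" "0 \<le> b" "b < 4 * int g" and b': "c' = of_int b'" "0 \<le> b'" "b' < 4 * int g"
    by auto
  have close: "\<tau> = \<epsilon>" "k = l" if "of_int k + \<tau> = of_int l + \<epsilon>" "\<bar>\<epsilon>\<bar> \<le> 1/4" for k l :: int and \<epsilon> :: real
  proof -
    have "\<bar>real_of_int (k - l)\<bar> < 1"
      using that \<tau> by auto
    then show "k = l"
      by linarith
    then show "\<tau> = \<epsilon>"
      using that(1) by simp
  qed
  show sep: "c = c' \<and> \<tau> = \<tau>'" if "polygon_point g (c + \<tau>) = polygon_point g (c' + \<tau>')"
  proof -
    from that polygon_point_eq_iff[OF genus_pos]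
    obtain n where n: "c + \<tau> = c' + \<tau>' + 4 * real g * of_int n"
      by blast
    then have *: "of_int b + \<tau> = of_int (b' + 4 * int g * n) + \<tau>'"
      by (simp add: b b')
    have "b = b' + 4 * int g * n"
      using close(2)[OF *] \<tau> by simp
    then have "b mod (4 * int g) = b' mod (4 * int g)"
      by simp
    then show ?thesis
      using close(1)[OF *] \<tau> b b' by simp
  qed
  fix \<mu> :: real
  assume \<mu>: "\<mu> \<in> {0..1}" and eq: "q (polygon_point g (c + \<tau>)) = q (polygon_point g (c' + \<tau>'))"
  consider "polygon_point g (c + \<tau>) = polygon_point g (c' + \<tau>')"
    | s where "s \<notin> \<int>" "polygon_point g (c + \<tau>) = polygon_point g s" "polygon_point g (c' + \<tau>') = polygon_point g (mate s)"
    | d e :: int where "polygon_point g (c + \<tau>) = polygon_point g (of_int d)" "polygon_point g (c' + \<tau>') = polygon_point g (of_int e)"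
    using eq unfolding q_polygon_point_eq_iff glued_def by blast
  then show "q (polygon_point g (c + \<mu> * \<tau>)) = q (polygon_point g (c' + \<mu> * \<tau>'))"
  proof cases
    case 1
    then show ?thesis using sep by simp
  next
    case (2 s)
    show ?thesis
    \<comment> \<open>At \<mu> = 0 both points are vertices, which are glued as one class and not
      through \<open>mate\<close>.\<close>
    proof (cases "\<mu> = 0")
      case True
      then show ?thesis
        using vertices b b' q_polygon_point_eq_iff by simp
    next
      case False
      then have \<mu>0: "0 < \<mu>" "\<mu> \<le> 1"
        using \<mu> by auto
      have nonint: "c + \<tau> \<notin> \<int>"
        using 2 polygon_point_noninteger[OF genus_pos, of "c + \<tau>" s] by simp
      then have "\<tau> \<noteq> 0"
        by (auto simp: b)
      have "polygon_point g (c' + \<tau>') = polygon_point g (mate (c + \<tau>))"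
        using 2 polygon_point_mate_cong[OF genus_pos, of "c + \<tau>" s] by simp
      then obtain n where n: "mate (c + \<tau>) = c' + \<tau>' + 4 * real g * of_int n"
        using polygon_point_eq_iff[OF genus_pos, of "mate (c + \<tau>)" "c' + \<tau>'"] by auto
      obtain l :: int where l: "mate (c + \<tau>) = of_int l - (c + \<tau>)"
        unfolding mate_def by blast
      have cl: "of_int b + \<tau> = of_int (l - b' - 4 * int g * n) + (- \<tau>')"
        using n l by (simp add: b b')
      \<comment> \<open>\<open>mate\<close> is a reflection, so glued points deviate from their
        vertices by opposite amounts.\<close>
      have \<tau>': "\<tau>' = - \<tau>"
        using close(1)[OF cl] \<tau> by simp
      \<comment> \<open>A positive factor \<mu> does not move the point across the vertex, hence it
        stays on the same side of the polygon, where \<open>mate\<close> is affine.\<close>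
      have fl: "\<lfloor>c + \<mu> * \<tau>\<rfloor> = \<lfloor>c + \<tau>\<rfloor>"
      proof (cases "0 < \<tau>")
        case True
        then have "0 < \<mu> * \<tau>" "\<mu> * \<tau> \<le> 1 * \<tau>"
          using \<mu>0 by (auto intro: mult_right_mono)
        then have "\<lfloor>c + \<mu> * \<tau>\<rfloor> = b" "\<lfloor>c + \<tau>\<rfloor> = b"
          using \<tau>(1) True unfolding b by (intro floor_unique; linarith)+
        then show ?thesis by simp
      next
        case False
        then have "\<tau> < 0"
          using \<open>\<tau> \<noteq> 0\<close> by simp
        then have "\<mu> * \<tau> < 0" "1 * \<tau> \<le> \<mu> * \<tau>"
          using \<mu>0 by (auto simp: mult_pos_neg intro!: mult_right_mono_neg)
        then have "\<lfloor>c + \<mu> * \<tau>\<rfloor> = b - 1" "\<lfloor>c + \<tau>\<rfloor> = b - 1"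
          using \<tau>(1) \<open>\<tau> < 0\<close> unfolding b by (intro floor_unique; simp; linarith)+
        then show ?thesis by simp
      qed
      have "c + \<mu> * \<tau> \<notin> \<int>"
      proof
        assume "c + \<mu> * \<tau> \<in> \<int>"
        then have "\<mu> * \<tau> \<in> \<int>"
          using Ints_diff[of "c + \<mu> * \<tau>" c] by (simp add: b)
        moreover have "\<bar>\<mu> * \<tau>\<bar> \<le> 1 * (1/4)"
          unfolding abs_mult using \<mu>0 \<tau> by (intro mult_mono) auto
        moreover have "\<mu> * \<tau> \<noteq> 0"
          using \<mu>0 \<open>\<tau> \<noteq> 0\<close> by simp
        ultimately show False
          using Ints_nonzero_abs_ge1 by fastforce
      qed
      moreover have "polygon_point g (c' + \<mu> * \<tau>') = polygon_point g (mate (c + \<mu> * \<tau>))"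
        unfolding mate_affine[OF fl] polygon_point_eq_iff[OF genus_pos] n \<tau>'
        by (intro exI[of _ "- n"]) simp
      ultimately have "\<exists>s. s \<notin> \<int> \<and> polygon_point g (c + \<mu> * \<tau>) = polygon_point g s \<and>
          polygon_point g (c' + \<mu> * \<tau>') = polygon_point g (mate s)"
        by blast
      then show ?thesis
        unfolding q_polygon_point_eq_iff glued_def by blast
    qed
  next
    case (3 d e)
    then have "c + \<tau> \<in> \<int>" "c' + \<tau>' \<in> \<int>"
      using polygon_point_noninteger[OF genus_pos, of "c + \<tau>" "of_int d"]
        polygon_point_noninteger[OF genus_pos, of "c' + \<tau>'" "of_int e"] by simp_all
    then have "\<tau> \<in> \<int>" "\<tau>' \<in> \<int>"
      using Ints_diff[of "c + \<tau>" c] Ints_diff[of "c' + \<tau>'" c'] by (simp_all add: b b')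
    then have "\<tau> = 0" "\<tau>' = 0"
      using \<tau> Ints_nonzero_abs_ge1 by fastforce+
    then show ?thesis
      using eq by simp
  qed
qed (use genus_pos in auto)

text \<open>The fibre is given by \<open>c0\<close> and \<open>mate c0\<close>. Near them all
  parameters stay inside two different open sides, and \<open>mate\<close> exchanges the two arcs
  while reversing the sign of the deviation; scaling the deviation respects this.\<close>

lemma edge_liftable:
  assumes c0: "c0 \<notin> \<int>"
  shows "locally_liftable (q (polygon_point g c0))"
proof -
  let ?I = "{c0, mate c0}"
  have c_nonint: "c \<notin> \<int>" if "c \<in> ?I" for c
    using that c0 by auto
  have lower: "of_int \<lfloor>c\<rfloor> < c" if "c \<in> ?I" for c
    using c_nonint[OF that] by (metis Ints_of_int le_less of_int_floor_le)
  \<comment> \<open>Half of the smallest distance to an end of a side, so that even the closed arcs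
    avoid the vertices.\<close>
  define \<delta> where "\<delta> = Min ((\<lambda>c. min (c - of_int \<lfloor>c\<rfloor>) (of_int \<lfloor>c\<rfloor> + 1 - c)) ` ?I) / 2"
  have pos: "0 < min (c - of_int \<lfloor>c\<rfloor>) (of_int \<lfloor>c\<rfloor> + 1 - c)" if "c \<in> ?I" for c
    using lower[OF that] by (simp add: less_diff_eq)
  have \<delta>: "0 < \<delta>"
    unfolding \<delta>_def using pos by auto
  have \<delta>_less: "\<delta> < min (c - of_int \<lfloor>c\<rfloor>) (of_int \<lfloor>c\<rfloor> + 1 - c)" if "c \<in> ?I" for c
  proof -
    have "2 * \<delta> \<le> min (c - of_int \<lfloor>c\<rfloor>) (of_int \<lfloor>c\<rfloor> + 1 - c)"
      unfolding \<delta>_def using that by auto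
    then show ?thesis
      using \<delta> by linarith
  qed
  have fl: "\<lfloor>c + \<tau>\<rfloor> = \<lfloor>c\<rfloor>" and nonint: "c + \<tau> \<notin> \<int>" if "c \<in> ?I" "\<bar>\<tau>\<bar> \<le> \<delta>" for c \<tau>
  proof -
    have *: "of_int \<lfloor>c\<rfloor> < c + \<tau>" "c + \<tau> < of_int \<lfloor>c\<rfloor> + 1"
      using \<delta>_less[OF that(1)] that(2) by auto
    then show "\<lfloor>c + \<tau>\<rfloor> = \<lfloor>c\<rfloor>"
      by (intro floor_unique) auto
    then show "c + \<tau> \<notin> \<int>"
      using * by (metis Ints_cases floor_of_int less_irrefl)
  qed
  have same_edge: "c = c' \<and> \<tau> = \<tau>'"
    if "c \<in> ?I" "c' \<in> ?I" "\<bar>\<tau>\<bar> \<le> \<delta>" "\<bar>\<tau>'\<bar> \<le> \<delta>" "polygon_point g (c + \<tau>) = polygon_point g (c' + \<tau>')" for c c' \<tau> \<tau>'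
  proof -
    from that polygon_point_eq_iff[OF genus_pos]
    obtain n where n: "c + \<tau> = c' + \<tau>' + 4 * real g * of_int n"
      by blast
    then have "c + \<tau> = c' + \<tau>' + of_int (4 * (int g * n))"
      by simp
    then have "\<lfloor>c + \<tau>\<rfloor> = \<lfloor>c' + \<tau>'\<rfloor> + 4 * (int g * n)"
      by (metis floor_add_int)
    then have fl_eq: "\<lfloor>c\<rfloor> = \<lfloor>c'\<rfloor> + 4 * (int g * n)"
      using fl that by simp
    then have "\<lfloor>c'\<rfloor> = \<lfloor>c\<rfloor> + 4 * (- (int g * n))"
      by simp
    with fl_eq have "c = c'"
      using that(1,2) floor_mate_neq[OF c0] by blast
    then have "int g * n = 0"
      using fl_eq by simp
    then have "n = 0"
      using genus_pos by simp
    then show ?thesis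
      using n \<open>c = c'\<close> by simp
  qed
  have mate_I: "mate c \<in> ?I" if "c \<in> ?I" for c
    using that mate_mate[OF c0] by auto
  have mate_centre: "mate (c + \<tau>) = mate c - \<tau>" if "c \<in> ?I" "\<bar>\<tau>\<bar> \<le> \<delta>" for c \<tau>
    using mate_affine[of c \<tau> 0] fl[OF that] by simp
  have glued_mate: "glued g (polygon_point g s) (polygon_point g (mate s))" if "s \<notin> \<int>" for s
    using that unfolding glued_def by blast
  show ?thesis
  proof (rule boundary_liftable[of ?I \<delta>])
    show "q (polygon_point g c) = q (polygon_point g c0)" if "c \<in> ?I" for c
      using that glued_sym[OF glued_mate[OF c0]] q_polygon_point_eq_iff by auto
    show "z \<in> polygon_point g ` ?I" if "z \<in> cball 0 1" "q z = q (polygon_point g c0)" for z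
    proof -
      have "glued g (polygon_point g c0) z"
        using that q_eq_iff[of "polygon_point g c0" z] by simp
      then consider "z = polygon_point g c0"
        | s where "polygon_point g c0 = polygon_point g s" "z = polygon_point g (mate s)"
        | a :: int where "polygon_point g c0 = polygon_point g (of_int a)"
        unfolding glued_def by blast
      then show ?thesis
      proof cases
        case 2
        then show ?thesis
          using polygon_point_mate_cong[OF genus_pos, of c0 s] by simp
      next
        case (3 a)
        then show ?thesis
          using polygon_point_noninteger[OF genus_pos, of c0 "of_int a"] c0 by simp
      qed simp
    qed
    show "q (polygon_point g c0) \<in> S"
      using img by (auto intro!: imageI)
    fix c c' \<tau> \<tau>' :: real
    assume I: "c \<in> ?I" "c' \<in> ?I" and \<tau>: "\<bar>\<tau>\<bar> \<le> \<delta>" "\<bar>\<tau>'\<bar> \<le> \<delta>"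
    show "c = c' \<and> \<tau> = \<tau>'" if "polygon_point g (c + \<tau>) = polygon_point g (c' + \<tau>')"
      using same_edge I \<tau> that by blast
    fix \<mu> :: real
    assume \<mu>: "\<mu> \<in> {0..1}" and eq: "q (polygon_point g (c + \<tau>)) = q (polygon_point g (c' + \<tau>'))"
    have \<mu>\<tau>: "\<bar>\<mu> * \<tau>\<bar> \<le> \<delta>"
    proof -
      have "\<bar>\<mu> * \<tau>\<bar> \<le> 1 * \<delta>"
        unfolding abs_mult using \<mu> \<tau> by (intro mult_mono) auto
      then show ?thesis by simp
    qed
    consider "polygon_point g (c + \<tau>) = polygon_point g (c' + \<tau>')"
      | s where "polygon_point g (c + \<tau>) = polygon_point g s" "polygon_point g (c' + \<tau>') = polygon_point g (mate s)"
      | d :: int where "polygon_point g (c + \<tau>) = polygon_point g (of_int d)"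
      using eq unfolding q_polygon_point_eq_iff glued_def by blast
    then show "q (polygon_point g (c + \<mu> * \<tau>)) = q (polygon_point g (c' + \<mu> * \<tau>'))"
    proof cases
      case 1
      then show ?thesis
        using same_edge[OF I \<tau>] by simp
    next
      case (2 s)
      then have "polygon_point g (c' + \<tau>') = polygon_point g (mate c + - \<tau>)"
        using polygon_point_mate_cong[OF genus_pos, of "c + \<tau>" s] mate_centre[OF I(1) \<tau>(1)] by simp
      then have "c' = mate c \<and> \<tau>' = - \<tau>"
        using \<tau> I by (intro same_edge mate_I) auto
      then have "c' + \<mu> * \<tau>' = mate (c + \<mu> * \<tau>)"
        using mate_centre[OF I(1) \<mu>\<tau>] by simp
      then show ?thesis
        using glued_mate[OF nonint[OF I(1) \<mu>\<tau>]] q_polygon_point_eq_iff by simp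
    next
      case (3 d)
      then show ?thesis
        using polygon_point_noninteger[OF genus_pos, of "c + \<tau>" "of_int d"] nonint[OF I(1) \<tau>(1)] by simp
    qed
  qed (use \<delta> in auto)
qed

lemma surface_locally_liftable:
  assumes "y \<in> S"
  shows "locally_liftable y"
proof -
  obtain z where z: "norm z \<le> 1" "y = q z"
    using assms img by auto
  show ?thesis
  proof (cases "norm z < 1")
    case True
    then show ?thesis
      using interior_liftable z by simp
  next
    case False
    then have "norm z = 1"
      using z by simp
    define s where "s = Arg z * (4 * real g) / (2 * pi)"
    have "2 * pi * s / (4 * real g) = Arg z"
      using genus_pos by (simp add: s_def)
    then have zs: "z = polygon_point g s"
      using rcis_cmod_Arg[of z] \<open>norm z = 1\<close> by (simp add: rcis_def polygon_point_def)
    show ?thesis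
    proof (cases "s \<in> \<int>")
      case True
      then show ?thesis
        using vertex_liftable z(2) zs by (auto elim!: Ints_cases)
    next
      case False
      then show ?thesis
        using edge_liftable z(2) zs by simp
    qed
  qed
qed

section \<open>Generation by the pairs of sides\<close>

definition side_loop :: "nat \<times> nat \<Rightarrow> (real \<Rightarrow> 'a) set" where
  "side_loop = (\<lambda>(j, e). ray_loop (polygon_point g (4 * real j + real e)) (polygon_point g (4 * real j + real e + 3)))"

lemma ray_loop_edge_gluing:
  assumes "edge_gluing g z w"
  shows "ray_loop z w \<in> side_loop ` ({..<g} \<times> {..<2})"
proof -
  obtain j t where j: "j < g" and t: "t \<in> {0..1::real}" and "(z = polygon_point g (4 * real j + t) \<and> w = polygon_point g (4 * real j + 3 - t)) \<or>
     (z = polygon_point g (4 * real j + 1 + t) \<and> w = polygon_point g (4 * real j + 4 - t))"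
    using assms unfolding edge_gluing_def by blast
  then have "\<exists>e::nat. e < 2 \<and> z = polygon_point g (4 * real j + real e + t) \<and>
      w = polygon_point g (4 * real j + real e + 3 - t)"
  proof (elim disjE conjE)
    assume "z = polygon_point g (4 * real j + t)" "w = polygon_point g (4 * real j + 3 - t)"
    then show ?thesis
      by (intro exI[of _ 0]) simp
  next
    assume "z = polygon_point g (4 * real j + 1 + t)" "w = polygon_point g (4 * real j + 4 - t)"
    then show ?thesis
      by (intro exI[of _ 1]) (simp add: algebra_simps)
  qed
  then obtain e :: nat where e: "e < 2" and z: "z = polygon_point g (4 * real j + real e + t)"
    and w: "w = polygon_point g (4 * real j + real e + 3 - t)"
    by blast
  \<comment> \<open>At \<sigma> = 0 these are the corners used by \<open>side_loop\<close>. They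
    then run along the two sides, glued at every time, and reach \<open>z\<close> and
    \<open>w\<close> at \<sigma> = 1.\<close>
  define u v where "u = (\<lambda>\<sigma>. polygon_point g (4 * real j + real e + \<sigma> * t))"
    and "v = (\<lambda>\<sigma>. polygon_point g (4 * real j + real e + 3 - \<sigma> * t))"
  have "ray_loop (pathfinish u) (pathfinish v) = ray_loop (pathstart u) (pathstart v)"
  proof (rule ray_loop_transport)
    show "path u" "path v"
      unfolding path_def u_def v_def by (intro continuous_intros)+
    show "path_image u \<subseteq> cball 0 1" "path_image v \<subseteq> cball 0 1"
      by (auto simp: path_image_def u_def v_def)
    show "q (u \<sigma>) = q (v \<sigma>)" if "\<sigma> \<in> {0..1}" for \<sigma>
    proof -
      have "\<sigma> * t \<in> {0..1}"
        using that t by (auto intro: mult_le_one)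
      moreover have "e = 0 \<or> e = 1"
        using e by auto
      ultimately have "edge_gluing g (u \<sigma>) (v \<sigma>)"
        unfolding edge_gluing_def using j
        by (intro exI[of _ j] conjI bexI[of _ "\<sigma> * t"]) (auto simp: u_def v_def algebra_simps)
      then show ?thesis
        unfolding u_def v_def q_polygon_point_eq_iff by (rule edge_gluing_imp_glued)
    qed
  qed
  then have "ray_loop z w = side_loop (j, e)"
    by (simp add: u_def v_def pathstart_def pathfinish_def z w side_loop_def)
  then show ?thesis
    using j e by blast
qed

theorem fundamental_group_generated_by_sides:
  obtains Y where "Y \<subseteq> carrier (fundamental_group S (q z0))" "finite Y" "card Y \<le> 2 * g"
    "generate (fundamental_group S (q z0)) Y = carrier (fundamental_group S (q z0))"
proof -
  let ?P = "fundamental_group S (q z0)"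
  define Y where "Y = side_loop ` ({..<g} \<times> {..<2})"
  have x: "q z0 \<in> S"
    using z0 img by auto
  interpret group ?P
    by (rule group_fundamental_group[OF x])
  have Y: "Y \<subseteq> carrier ?P"
  proof -
    have "side_loop (j, e) \<in> carrier ?P" if "j < g" "e < 2" for j e
    proof -
      have "e = 0 \<or> e = 1"
        using that by auto
      then have "edge_gluing g (polygon_point g (4 * real j + real e)) (polygon_point g (4 * real j + real e + 3))"
        unfolding edge_gluing_def using that by (intro exI[of _ j] conjI bexI[of _ 0]) (auto simp: algebra_simps)
      then have "q (polygon_point g (4 * real j + real e)) = q (polygon_point g (4 * real j + real e + 3))"
        unfolding q_polygon_point_eq_iff by (rule edge_gluing_imp_glued)
      then show ?thesis
        unfolding side_loop_def by (simp add: ray_loop_carrier)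
    qed
    then show ?thesis
      by (auto simp: Y_def)
  qed
  have H: "subgroup (generate ?P Y) ?P"
    using generate_is_subgroup[OF Y] .
  have card: "card Y \<le> 2 * g"
    using card_image_le[of "{..<g} \<times> {..<2::nat}" side_loop] by (simp add: Y_def card_cartesian_product mult.commute)
  have edge: "ray_loop z w \<in> generate ?P Y" "ray_loop w z \<in> generate ?P Y" "z \<in> cball 0 1" "w \<in> cball 0 1" "q z = q w"
    if "edge_gluing g z w" for z w
  proof -
    show D: "z \<in> cball 0 1" "w \<in> cball 0 1"
      using that unfolding edge_gluing_def by auto
    show eq: "q z = q w"
      using that D q_eq_iff edge_gluing_imp_glued by blast
    show 1: "ray_loop z w \<in> generate ?P Y"
      using ray_loop_edge_gluing[OF that] by (auto simp: Y_def intro: generate.incl)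
    show "ray_loop w z \<in> generate ?P Y"
      using ray_loop_inverse[OF D eq] subgroup.m_inv_closed[OF H 1] by simp
  qed
  have "ray_loop z w \<in> generate ?P Y" if "z \<in> cball 0 1" "w \<in> cball 0 1" "q z = q w" for z w
  proof -
    have "equivclp (edge_gluing g) z w"
      using that q_eq_iff equivclp_edge_gluing_iff[OF genus_pos] by simp
    \<comment> \<open>Induction along the chain of elementary gluings: by the cocycle rule each link
      multiplies by a side loop or the inverse of one.\<close>
    then have "w \<in> cball 0 1 \<and> q z = q w \<and> ray_loop z w \<in> generate ?P Y"
    proof (induction rule: equivclp_induct)
      case base
      then show ?case
        using that(1) ray_loop_self[of z] generate.one[of ?P Y] by simp
    next
      case (step y w)
      then have yw: "ray_loop y w \<in> generate ?P Y" "w \<in> cball 0 1" "q y = q w"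
        using edge[of y w] edge[of w y] by auto
      then have "ray_loop z y \<otimes>\<^bsub>?P\<^esub> ray_loop y w = ray_loop z w"
        using step.IH that(1) by (intro ray_loop_mult) auto
      then show ?case
        using subgroup.m_closed[OF H, of "ray_loop z y" "ray_loop y w"] yw step.IH by simp
    qed
    then show ?thesis by simp
  qed
  then have "generate ?P Y = carrier ?P"
    by (intro fundamental_group_generated surface_locally_liftable Y)
  then show thesis
    using that Y card by (simp add: Y_def)
qed

end

lemma surface_group_generators:
  assumes "surface_group_of_genus g H" "group H"
  obtains Y where "Y \<subseteq> carrier H" "finite Y" "card Y \<le> 2 * g" "generate H Y = carrier H"
proof -
  obtain S :: "(real ^ 3) set" and x where S: "closed_orientable_surface g S" "x \<in> S"
    and iso: "H \<cong> fundamental_group S x"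
    using assms(1) unfolding surface_group_of_genus_def by blast
  obtain q where g: "1 \<le> g" and qm: "quotient_map (top_of_set (cball 0 1)) (top_of_set S) q"
    and eq: "\<And>z w. z \<in> cball 0 1 \<Longrightarrow> w \<in> cball 0 1 \<Longrightarrow> q z = q w \<longleftrightarrow> equivclp (edge_gluing g) z w"
    using S(1) unfolding closed_orientable_surface_def by blast
  have img: "q ` cball 0 1 = S"
    using quotient_imp_surjective_map[OF qm] by simp
  have cont: "continuous_on (cball 0 1) q"
    using quotient_imp_continuous_map[OF qm] by simp
  obtain z0 where base: "z0 \<in> cball 0 1" "x = q z0"
    using S(2) img by blast
  interpret glued_polygon S q z0 g
    by unfold_locales (use img cont base g eq equivclp_edge_gluing_iff[OF g] in auto)
  interpret P: group "fundamental_group S x"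
    using S(2) by (rule group_fundamental_group)
  obtain Y where Y: "Y \<subseteq> carrier (fundamental_group S x)" "finite Y" "card Y \<le> 2 * g"
    "generate (fundamental_group S x) Y = carrier (fundamental_group S x)"
    using fundamental_group_generated_by_sides base(2) by blast
  obtain f where f: "f \<in> iso (fundamental_group S x) H"
    using group.iso_sym[OF assms(2) iso] unfolding is_iso_def by blast
  interpret f: group_hom "fundamental_group S x" H f
    using f assms(2) by (auto simp: group_hom_def group_hom_axioms_def iso_def P.group_axioms)
  have surj: "f ` carrier (fundamental_group S x) = carrier H"
    using f by (auto simp: iso_def bij_betw_def)
  show thesis
  proof (rule that[of "f ` Y"])
    show "f ` Y \<subseteq> carrier H"
      using Y(1) surj by blast
    show "card (f ` Y) \<le> 2 * g"
      using card_image_le[OF Y(2), of f] Y(3) by simp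
    show "generate H (f ` Y) = carrier H"
      using f.generate_img[OF Y(1)] Y(4) surj by simp
  qed (use Y in simp)
qed

section \<open>Counting lifted subgroups\<close>

text \<open>Reading a word in \<open>Y\<close> from the coset \<open>k\<close>, consecutive
  representatives cancel, so the Schreier elements of its letters telescope. A word in the kernel
  that starts at the trivial coset returns there, and \<open>T \<one> = \<one>\<close> leaves the
  word itself. The subgroup \<open>E\<close> will be the equalizer of two lifts.\<close>

lemma schreier_generation:
  assumes "group_hom H Q a" and Y: "Y \<subseteq> carrier H" "generate H Y = carrier H"
    and T: "\<And>k. k \<in> carrier Q \<Longrightarrow> T k \<in> carrier H" "T \<one>\<^bsub>Q\<^esub> = \<one>\<^bsub>H\<^esub>"
    and E: "subgroup E H"
    and schreier: "\<And>k y. k \<in> carrier Q \<Longrightarrow> y \<in> Y \<Longrightarrow>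
      T k \<otimes>\<^bsub>H\<^esub> y \<otimes>\<^bsub>H\<^esub> inv\<^bsub>H\<^esub> T (k \<otimes>\<^bsub>Q\<^esub> a y) \<in> E"
  shows "kernel H Q a \<subseteq> E"
proof
  interpret H: group H
    using assms(1) by (rule group_hom.axioms)
  interpret Q: group Q
    using assms(1) by (rule group_hom.axioms)
  interpret a: group_hom H Q a by fact
  have gen: "T k \<otimes>\<^bsub>H\<^esub> x \<otimes>\<^bsub>H\<^esub> inv\<^bsub>H\<^esub> T (k \<otimes>\<^bsub>Q\<^esub> a x) \<in> E"
    if "x \<in> generate H Y" "k \<in> carrier Q" for x k
    using that
  proof (induction arbitrary: k rule: generate.induct)
    case one
    then show ?case
      using T(1) subgroup.one_closed[OF E] by simp
  next
    case (incl y)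
    then show ?case
      using schreier by simp
  next
    case (inv y)
    then have y: "y \<in> carrier H"
      using Y(1) by blast
    \<comment> \<open>Reading the inverse of \<open>y\<close> from \<open>k\<close> undoes the
      Schreier element that reads \<open>y\<close> from this coset.\<close>
    let ?k = "k \<otimes>\<^bsub>Q\<^esub> inv\<^bsub>Q\<^esub> a y"
    have k: "?k \<in> carrier Q" "?k \<otimes>\<^bsub>Q\<^esub> a y = k"
      using inv.prems y by (simp_all add: Q.m_assoc)
    have "inv\<^bsub>H\<^esub> (T ?k \<otimes>\<^bsub>H\<^esub> y \<otimes>\<^bsub>H\<^esub> inv\<^bsub>H\<^esub> T k) \<in> E"
      using schreier[OF k(1) inv.hyps] subgroup.m_inv_closed[OF E] k(2) by simp
    moreover have "inv\<^bsub>H\<^esub> (T ?k \<otimes>\<^bsub>H\<^esub> y \<otimes>\<^bsub>H\<^esub> inv\<^bsub>H\<^esub> T k) = T k \<otimes>\<^bsub>H\<^esub> inv\<^bsub>H\<^esub> y \<otimes>\<^bsub>H\<^esub> inv\<^bsub>H\<^esub> T ?k"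
      using T(1)[OF k(1)] T(1)[OF inv.prems] y by (simp add: H.inv_mult_group H.m_assoc)
    ultimately show ?case
      using y by simp
  next
    case (eng x x')
    then have x: "x \<in> carrier H" "x' \<in> carrier H"
      using Y(2) by auto
    let ?k = "k \<otimes>\<^bsub>Q\<^esub> a x"
    have k: "?k \<in> carrier Q" "?k \<otimes>\<^bsub>Q\<^esub> a x' \<in> carrier Q"
      using x eng.prems by auto
    have c: "T k \<in> carrier H" "T ?k \<in> carrier H" "T (?k \<otimes>\<^bsub>Q\<^esub> a x') \<in> carrier H"
      using T(1) k eng.prems by auto
    have "(T k \<otimes>\<^bsub>H\<^esub> x \<otimes>\<^bsub>H\<^esub> inv\<^bsub>H\<^esub> T ?k) \<otimes>\<^bsub>H\<^esub> (T ?k \<otimes>\<^bsub>H\<^esub> x' \<otimes>\<^bsub>H\<^esub> inv\<^bsub>H\<^esub> T (?k \<otimes>\<^bsub>Q\<^esub> a x')) \<in> E"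
      using eng.IH(1)[OF eng.prems] eng.IH(2)[OF k(1)] subgroup.m_closed[OF E] by simp
    moreover have "inv\<^bsub>H\<^esub> T ?k \<otimes>\<^bsub>H\<^esub> (T ?k \<otimes>\<^bsub>H\<^esub> v) = v" if "v \<in> carrier H" for v
      using c that by (simp add: H.m_assoc[symmetric])
    ultimately have "T k \<otimes>\<^bsub>H\<^esub> x \<otimes>\<^bsub>H\<^esub> (x' \<otimes>\<^bsub>H\<^esub> inv\<^bsub>H\<^esub> T (?k \<otimes>\<^bsub>Q\<^esub> a x')) \<in> E"
      using c x by (simp add: H.m_assoc)
    then show ?case
      using c x eng.prems by (simp add: H.m_assoc Q.m_assoc)
  qed
  fix x assume "x \<in> kernel H Q a"
  then have x: "x \<in> carrier H" "a x = \<one>\<^bsub>Q\<^esub>"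
    by (auto simp: kernel_def)
  then show "x \<in> E"
    using gen[of x "\<one>\<^bsub>Q\<^esub>"] Y(2) T(2) by simp
qed

lemma hom_equalizer_subgroup:
  assumes "group_hom H L f" "group_hom H L f'"
  shows "subgroup {x \<in> carrier H. f x = f' x} H"
proof -
  interpret H: group H
    using assms(1) by (rule group_hom.axioms)
  interpret f: group_hom H L f by fact
  interpret f': group_hom H L f' by fact
  show ?thesis
    by (intro H.subgroupI) (auto intro: exI[of _ "\<one>\<^bsub>H\<^esub>"])
qed

lemma card_image_le_of_code:
  assumes "finite C" "code ` A \<subseteq> C"
    and "\<And>x y. x \<in> A \<Longrightarrow> y \<in> A \<Longrightarrow> code x = code y \<Longrightarrow> f x = f y"
  shows "finite (f ` A)" "card (f ` A) \<le> card C"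
proof -
  have "f x = f (inv_into A code (code x))" if "x \<in> A" for x
    using that assms(3)[of x "inv_into A code (code x)"] by (simp add: f_inv_into_f inv_into_into)
  then have "f ` A \<subseteq> (f \<circ> inv_into A code) ` code ` A"
    by force
  then have sub: "f ` A \<subseteq> (f \<circ> inv_into A code) ` C"
    using assms(2) by blast
  then show "finite (f ` A)"
    using assms(1) finite_surj by blast
  show "card (f ` A) \<le> card C"
    using sub assms(1) surj_card_le by blast
qed

text \<open>Orbit-stabilizer for the conjugation of subsets. Finiteness is stated apart because
  \<open>card\<close> is 0 on infinite sets, so equal cardinalities alone would not give it.\<close>

lemma (in group) rcosets_normalizer:
  assumes "H \<subseteq> carrier G"
  defines "conjs \<equiv> (\<lambda>g. g <# H #> inv g) ` carrier G"
  shows "finite (rcosets (normalizer G H)) \<longleftrightarrow> finite conjs" "card (rcosets (normalizer G H)) = card conjs"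
proof -
  let ?\<psi> = "\<lambda>g. \<lambda>H \<in> {H. H \<subseteq> carrier G}. g <# H #> (inv g)"
  interpret group_action G "{H. H \<subseteq> carrier G}" ?\<psi>
    by (rule action_by_conjugation_on_power_set)
  have "bij_betw (\<lambda>R. (?\<psi> (inv (SOME h. h \<in> R))) H) (rcosets (stabilizer G ?\<psi> H)) (orbit G ?\<psi> H)"
    using assms(1) by (intro orbit_stab_fun_is_bij) simp
  moreover have "orbit G ?\<psi> H = conjs"
    using assms(1) by (auto simp: orbit_def conjs_def)
  ultimately have "bij_betw (\<lambda>R. (?\<psi> (inv (SOME h. h \<in> R))) H) (rcosets (normalizer G H)) conjs"
    by (simp add: normalizer_def)
  then show "finite (rcosets (normalizer G H)) \<longleftrightarrow> finite conjs" "card (rcosets (normalizer G H)) = card conjs"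
    using bij_betw_finite bij_betw_same_card by blast+
qed

text \<open>The conjugate of \<open>i ` K\<close> by \<open>\<gamma>\<close> is the image of the lift \<open>j \<gamma>\<close> of the conjugate of \<open>K\<close>, which
  is the kernel of a homomorphism \<open>a \<gamma>\<close> onto the quotient by \<open>K\<close>. Hence it is encoded by the values
  of \<open>a \<gamma>\<close> on \<open>Y\<close> and of \<open>j \<gamma>\<close> on the Schreier generators, each of the latter being determined up to
  the kernel of \<open>\<phi>\<close>.\<close>

theorem lift_normalizer_index:
  fixes G :: "('g, 'l) monoid_scheme" and \<Gamma> :: "('e, 'k) monoid_scheme"
  assumes \<phi>: "group_hom \<Gamma> G \<phi>" "\<phi> ` carrier \<Gamma> = carrier G" "finite (kernel \<Gamma> G \<phi>)"
    and F: "F \<lhd> G"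
    and Y: "Y \<subseteq> F" "finite Y" "generate (G\<lparr>carrier := F\<rparr>) Y = F"
    and K: "K \<lhd> G\<lparr>carrier := F\<rparr>" "finite (rcosets\<^bsub>G\<lparr>carrier := F\<rparr>\<^esub> K)"
    and lift: "is_lift \<Gamma> \<phi> G K i"
  defines "m \<equiv> card (rcosets\<^bsub>G\<lparr>carrier := F\<rparr>\<^esub> K)"
  shows "finite (rcosets\<^bsub>\<Gamma>\<^esub> (normalizer \<Gamma> (i ` K)))"
    and "card (rcosets\<^bsub>\<Gamma>\<^esub> (normalizer \<Gamma> (i ` K))) \<le> m ^ card Y * card (kernel \<Gamma> G \<phi>) ^ (m * card Y)"
proof -
  interpret \<Gamma>: group \<Gamma>
    using \<phi>(1) by (rule group_hom.axioms)
  interpret G: group G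
    using \<phi>(1) by (rule group_hom.axioms)
  interpret \<phi>: group_hom \<Gamma> G \<phi> by fact
  interpret F: normal F G by fact
  let ?F = "G\<lparr>carrier := F\<rparr>"
  let ?Q = "?F Mod K"
  interpret F': group ?F
    by (rule F.subgroup_is_group[OF G.group_axioms])
  interpret K: normal K ?F by fact
  interpret Q: group ?Q
    by (rule K.factorgroup_is_group)
  have FG: "x \<in> carrier G" if "x \<in> F" for x
    using that F.subset by blast
  have KF: "x \<in> F" if "x \<in> K" for x
    using that K.subset by auto
  have i: "i \<in> hom (G\<lparr>carrier := K\<rparr>) \<Gamma>" and \<phi>i: "\<And>x. x \<in> K \<Longrightarrow> \<phi> (i x) = x"
    using lift by (auto simp: is_lift_def)
  have i_closed: "i x \<in> carrier \<Gamma>" if "x \<in> K" for x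
    using i that by (auto simp: hom_def)
  have i_mult: "i (x \<otimes>\<^bsub>G\<^esub> y) = i x \<otimes>\<^bsub>\<Gamma>\<^esub> i y" if "x \<in> K" "y \<in> K" for x y
    using i that by (auto simp: hom_def)

  \<comment> \<open>Conjugation in the inverse direction, so that \<open>c \<gamma>\<close> carries
    the conjugate subgroup \<open>L \<gamma>\<close> back to \<open>K\<close>.\<close>
  define c where "c \<gamma> x = inv\<^bsub>G\<^esub> (\<phi> \<gamma>) \<otimes>\<^bsub>G\<^esub> x \<otimes>\<^bsub>G\<^esub> \<phi> \<gamma>" for \<gamma> x
  have c_F: "c \<gamma> x \<in> F" if "\<gamma> \<in> carrier \<Gamma>" "x \<in> F" for \<gamma> x
    using that by (simp add: c_def F.inv_op_closed1)
  have c_mult: "c \<gamma> (x \<otimes>\<^bsub>G\<^esub> y) = c \<gamma> x \<otimes>\<^bsub>G\<^esub> c \<gamma> y" if "\<gamma> \<in> carrier \<Gamma>" "x \<in> F" "y \<in> F" for \<gamma> x y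
  proof -
    have "\<phi> \<gamma> \<otimes>\<^bsub>G\<^esub> (inv\<^bsub>G\<^esub> (\<phi> \<gamma>) \<otimes>\<^bsub>G\<^esub> v) = v" if "v \<in> carrier G" for v
      using that \<open>\<gamma> \<in> carrier \<Gamma>\<close> by (simp add: G.m_assoc[symmetric])
    then show ?thesis
      using that by (simp add: c_def G.m_assoc FG)
  qed
  have c_cancel: "c \<gamma> (\<phi> \<gamma> \<otimes>\<^bsub>G\<^esub> x \<otimes>\<^bsub>G\<^esub> inv\<^bsub>G\<^esub> (\<phi> \<gamma>)) = x"
    "\<phi> \<gamma> \<otimes>\<^bsub>G\<^esub> x \<otimes>\<^bsub>G\<^esub> inv\<^bsub>G\<^esub> (\<phi> \<gamma>) \<in> F" "\<phi> \<gamma> \<otimes>\<^bsub>G\<^esub> c \<gamma> x \<otimes>\<^bsub>G\<^esub> inv\<^bsub>G\<^esub> (\<phi> \<gamma>) = x"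
    if "\<gamma> \<in> carrier \<Gamma>" "x \<in> F" for \<gamma> x
  proof -
    have *: "inv\<^bsub>G\<^esub> (\<phi> \<gamma>) \<otimes>\<^bsub>G\<^esub> (\<phi> \<gamma> \<otimes>\<^bsub>G\<^esub> v) = v" "\<phi> \<gamma> \<otimes>\<^bsub>G\<^esub> (inv\<^bsub>G\<^esub> (\<phi> \<gamma>) \<otimes>\<^bsub>G\<^esub> v) = v" if "v \<in> carrier G" for v
      using that \<open>\<gamma> \<in> carrier \<Gamma>\<close> by (simp_all add: G.m_assoc[symmetric])
    show "c \<gamma> (\<phi> \<gamma> \<otimes>\<^bsub>G\<^esub> x \<otimes>\<^bsub>G\<^esub> inv\<^bsub>G\<^esub> (\<phi> \<gamma>)) = x" "\<phi> \<gamma> \<otimes>\<^bsub>G\<^esub> c \<gamma> x \<otimes>\<^bsub>G\<^esub> inv\<^bsub>G\<^esub> (\<phi> \<gamma>) = x"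
      using that * by (simp_all add: c_def G.m_assoc FG)
    show "\<phi> \<gamma> \<otimes>\<^bsub>G\<^esub> x \<otimes>\<^bsub>G\<^esub> inv\<^bsub>G\<^esub> (\<phi> \<gamma>) \<in> F"
      using that by (simp add: F.inv_op_closed2)
  qed

  \<comment> \<open>The restriction to \<open>F\<close> makes homomorphisms that agree on
    \<open>F\<close> equal as functions, so that everything defined from them, in particular the
    transversal, agrees as well.\<close>
  define a where "a \<gamma> = (\<lambda>x\<in>F. K #>\<^bsub>?F\<^esub> c \<gamma> x)" for \<gamma>
  have a_hom: "group_hom ?F ?Q (a \<gamma>)" if "\<gamma> \<in> carrier \<Gamma>" for \<gamma>
  proof -
    have \<pi>: "(\<lambda>x. K #>\<^bsub>?F\<^esub> x) \<in> hom ?F ?Q"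
      by (rule K.r_coset_hom_Mod)
    have "a \<gamma> \<in> hom ?F ?Q"
      using hom_in_carrier[OF \<pi>] hom_mult[OF \<pi>] c_F[OF that] c_mult[OF that]
      by (intro homI) (simp_all add: a_def F.m_closed)
    then show ?thesis
      by (simp add: group_hom_def group_hom_axioms_def F'.group_axioms Q.group_axioms)
  qed
  have a_surj: "\<exists>t\<in>F. a \<gamma> t = k" if "\<gamma> \<in> carrier \<Gamma>" "k \<in> carrier ?Q" for \<gamma> k
  proof -
    obtain z where "z \<in> F" "k = K #>\<^bsub>?F\<^esub> z"
      using \<open>k \<in> carrier ?Q\<close> by (auto simp: FactGroup_def RCOSETS_def)
    then show ?thesis
      using c_cancel[OF \<open>\<gamma> \<in> carrier \<Gamma>\<close>, of z]
      by (intro bexI[of _ "\<phi> \<gamma> \<otimes>\<^bsub>G\<^esub> z \<otimes>\<^bsub>G\<^esub> inv\<^bsub>G\<^esub> (\<phi> \<gamma>)"]) (simp_all add: a_def)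
  qed
  define L where "L \<gamma> = kernel ?F ?Q (a \<gamma>)" for \<gamma>
  have L_iff: "x \<in> L \<gamma> \<longleftrightarrow> x \<in> F \<and> c \<gamma> x \<in> K" if "\<gamma> \<in> carrier \<Gamma>" for \<gamma> x
  proof -
    have "K #>\<^bsub>?F\<^esub> v = K \<longleftrightarrow> v \<in> K" if "v \<in> F" for v
    proof
      have v: "v \<in> carrier ?F"
        using that by simp
      show "v \<in> K" if "K #>\<^bsub>?F\<^esub> v = K"
        using that v K.subgroup_axioms by (rule F'.coset_join1)
      show "K #>\<^bsub>?F\<^esub> v = K" if "v \<in> K"
        using v K.subgroup_axioms that by (rule F'.coset_join2)
    qed
    then show ?thesis
      using c_F[OF that] by (auto simp: L_def kernel_def a_def FactGroup_def)
  qed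
  have L_sub: "subgroup (L \<gamma>) ?F" if "\<gamma> \<in> carrier \<Gamma>" for \<gamma>
    unfolding L_def by (rule group_hom.subgroup_kernel[OF a_hom[OF that]])

  define j where "j \<gamma> x = \<gamma> \<otimes>\<^bsub>\<Gamma>\<^esub> i (c \<gamma> x) \<otimes>\<^bsub>\<Gamma>\<^esub> inv\<^bsub>\<Gamma>\<^esub> \<gamma>" for \<gamma> x
  have j_closed: "j \<gamma> x \<in> carrier \<Gamma>" if "\<gamma> \<in> carrier \<Gamma>" "x \<in> L \<gamma>" for \<gamma> x
    using that L_iff i_closed by (simp add: j_def)
  have \<phi>j: "\<phi> (j \<gamma> x) = x" if "\<gamma> \<in> carrier \<Gamma>" "x \<in> L \<gamma>" for \<gamma> x
    using that L_iff[OF that(1)] i_closed \<phi>i c_cancel(3) by (simp add: j_def)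
  have j_hom: "group_hom (?F\<lparr>carrier := L \<gamma>\<rparr>) \<Gamma> (j \<gamma>)" if "\<gamma> \<in> carrier \<Gamma>" for \<gamma>
  proof -
    have "j \<gamma> (x \<otimes>\<^bsub>G\<^esub> y) = j \<gamma> x \<otimes>\<^bsub>\<Gamma>\<^esub> j \<gamma> y" if "x \<in> L \<gamma>" "y \<in> L \<gamma>" for x y
    proof -
      have xy: "x \<in> F" "y \<in> F" "c \<gamma> x \<in> K" "c \<gamma> y \<in> K"
        using that L_iff \<open>\<gamma> \<in> carrier \<Gamma>\<close> by auto
      have "inv\<^bsub>\<Gamma>\<^esub> \<gamma> \<otimes>\<^bsub>\<Gamma>\<^esub> (\<gamma> \<otimes>\<^bsub>\<Gamma>\<^esub> v) = v" if "v \<in> carrier \<Gamma>" for v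
        using that \<open>\<gamma> \<in> carrier \<Gamma>\<close> by (simp add: \<Gamma>.m_assoc[symmetric])
      then show ?thesis
        using xy \<open>\<gamma> \<in> carrier \<Gamma>\<close> i_closed by (simp add: j_def c_mult i_mult \<Gamma>.m_assoc)
    qed
    then have "j \<gamma> \<in> hom (?F\<lparr>carrier := L \<gamma>\<rparr>) \<Gamma>"
      using j_closed[OF that] by (auto simp: hom_def)
    then show ?thesis
      using subgroup.subgroup_is_group[OF L_sub[OF that] F'.group_axioms]
      by (simp add: group_hom_def group_hom_axioms_def \<Gamma>.group_axioms)
  qed
  have conj: "\<gamma> <#\<^bsub>\<Gamma>\<^esub> (i ` K) #>\<^bsub>\<Gamma>\<^esub> inv\<^bsub>\<Gamma>\<^esub> \<gamma> = j \<gamma> ` L \<gamma>" if "\<gamma> \<in> carrier \<Gamma>" for \<gamma>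
  proof -
    have "c \<gamma> ` L \<gamma> = K"
    proof
      show "c \<gamma> ` L \<gamma> \<subseteq> K"
        using L_iff[OF that] by auto
      show "K \<subseteq> c \<gamma> ` L \<gamma>"
      proof
        fix x assume x: "x \<in> K"
        let ?x = "\<phi> \<gamma> \<otimes>\<^bsub>G\<^esub> x \<otimes>\<^bsub>G\<^esub> inv\<^bsub>G\<^esub> (\<phi> \<gamma>)"
        have "?x \<in> L \<gamma>" "x = c \<gamma> ?x"
          using c_cancel[OF that KF[OF x]] x L_iff[OF that] by simp_all
        then show "x \<in> c \<gamma> ` L \<gamma>"
          by blast
      qed
    qed
    then have "\<gamma> <#\<^bsub>\<Gamma>\<^esub> (i ` K) #>\<^bsub>\<Gamma>\<^esub> inv\<^bsub>\<Gamma>\<^esub> \<gamma> = (\<lambda>x. \<gamma> \<otimes>\<^bsub>\<Gamma>\<^esub> i x \<otimes>\<^bsub>\<Gamma>\<^esub> inv\<^bsub>\<Gamma>\<^esub> \<gamma>) ` c \<gamma> ` L \<gamma>"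
      by (auto simp: l_coset_def r_coset_def)
    then show ?thesis
      by (simp add: image_image j_def)
  qed

  \<comment> \<open>The choice depends on the homomorphism \<open>b\<close> alone, so elements
    \<gamma> with the same \<open>a \<gamma>\<close> share their Schreier elements. The trivial
    coset gets \<open>\<one>\<close>, as Schreier's argument demands.\<close>
  define T where "T b k = (if k = \<one>\<^bsub>?Q\<^esub> then \<one>\<^bsub>G\<^esub> else (SOME t. t \<in> F \<and> b t = k))" for b :: "'g \<Rightarrow> 'g set" and k
  have T: "T (a \<gamma>) k \<in> F" "a \<gamma> (T (a \<gamma>) k) = k" if "\<gamma> \<in> carrier \<Gamma>" "k \<in> carrier ?Q" for \<gamma> k
  proof -
    interpret a: group_hom ?F ?Q "a \<gamma>"
      by (rule a_hom[OF that(1)])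
    have "\<exists>t. t \<in> F \<and> a \<gamma> t = k"
      using a_surj[OF that] by blast
    then have "(SOME t. t \<in> F \<and> a \<gamma> t = k) \<in> F \<and> a \<gamma> (SOME t. t \<in> F \<and> a \<gamma> t = k) = k"
      by (rule someI_ex)
    moreover have "a \<gamma> \<one>\<^bsub>G\<^esub> = \<one>\<^bsub>?Q\<^esub>"
      using a.hom_one by simp
    ultimately show "T (a \<gamma>) k \<in> F" "a \<gamma> (T (a \<gamma>) k) = k"
      by (simp_all add: T_def)
  qed
  define sch where "sch b k y = T b k \<otimes>\<^bsub>G\<^esub> y \<otimes>\<^bsub>G\<^esub> inv\<^bsub>?F\<^esub> T b (k \<otimes>\<^bsub>?Q\<^esub> b y)" for b k y
  have sch_L: "sch (a \<gamma>) k y \<in> L \<gamma>" if \<gamma>: "\<gamma> \<in> carrier \<Gamma>" and k: "k \<in> carrier ?Q" and y: "y \<in> Y" for \<gamma> k y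
  proof -
    interpret a: group_hom ?F ?Q "a \<gamma>"
      by (rule a_hom[OF \<gamma>])
    have y': "y \<in> carrier ?F"
      using y Y(1) by auto
    define k' where "k' = k \<otimes>\<^bsub>?Q\<^esub> a \<gamma> y"
    have k': "k' \<in> carrier ?Q"
      unfolding k'_def using k y' by (intro Q.m_closed a.hom_closed)
    have t: "T (a \<gamma>) k \<in> carrier ?F" "T (a \<gamma>) k' \<in> carrier ?F"
      using T(1)[OF \<gamma>] k k' by auto
    have s: "sch (a \<gamma>) k y = T (a \<gamma>) k \<otimes>\<^bsub>?F\<^esub> y \<otimes>\<^bsub>?F\<^esub> inv\<^bsub>?F\<^esub> T (a \<gamma>) k'"
      by (simp add: sch_def k'_def)
    have closed: "sch (a \<gamma>) k y \<in> carrier ?F"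
      unfolding s using t y' by (intro F'.m_closed F'.inv_closed)
    have "a \<gamma> (sch (a \<gamma>) k y) = (k \<otimes>\<^bsub>?Q\<^esub> a \<gamma> y) \<otimes>\<^bsub>?Q\<^esub> inv\<^bsub>?Q\<^esub> k'"
      unfolding s using t y' T(2)[OF \<gamma> k] T(2)[OF \<gamma> k']
      by (simp only: a.hom_mult a.hom_inv F'.m_closed F'.inv_closed)
    also have "\<dots> = \<one>\<^bsub>?Q\<^esub>"
      using Q.r_inv[OF k'] by (simp only: k'_def)
    finally show ?thesis
      using closed by (simp add: L_def kernel_def)
  qed

  \<comment> \<open>A reference preimage chosen independently of \<gamma>. Both
    \<open>j \<gamma> s\<close> and \<open>\<theta> s\<close> lie over \<open>s\<close>, so their
    quotient lies in the kernel of \<open>\<phi>\<close> and determines \<open>j \<gamma> s\<close>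
    once \<open>s\<close> is known.\<close>
  define \<theta> where "\<theta> x = (SOME e. e \<in> carrier \<Gamma> \<and> \<phi> e = x)" for x
  have \<theta>: "\<theta> x \<in> carrier \<Gamma>" "\<phi> (\<theta> x) = x" if "x \<in> carrier G" for x
  proof -
    have "\<exists>e. e \<in> carrier \<Gamma> \<and> \<phi> e = x"
      using that unfolding \<phi>(2)[symmetric] by auto
    then have "\<theta> x \<in> carrier \<Gamma> \<and> \<phi> (\<theta> x) = x"
      unfolding \<theta>_def by (rule someI_ex)
    then show "\<theta> x \<in> carrier \<Gamma>" "\<phi> (\<theta> x) = x"
      by auto
  qed
  have L_G: "x \<in> carrier G" if "\<gamma> \<in> carrier \<Gamma>" "x \<in> L \<gamma>" for \<gamma> x
    using that L_iff FG by blast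

  define code where "code \<gamma> = (restrict (a \<gamma>) Y,
      \<lambda>(k, y)\<in>carrier ?Q \<times> Y. j \<gamma> (sch (a \<gamma>) k y) \<otimes>\<^bsub>\<Gamma>\<^esub> inv\<^bsub>\<Gamma>\<^esub> \<theta> (sch (a \<gamma>) k y))" for \<gamma>
  let ?C = "(Y \<rightarrow>\<^sub>E carrier ?Q) \<times> (carrier ?Q \<times> Y \<rightarrow>\<^sub>E kernel \<Gamma> G \<phi>)"
  have Q_fin: "finite (carrier ?Q)" and Q_card: "card (carrier ?Q) = m"
    using K(2) by (simp_all add: FactGroup_def m_def)
  have C_fin: "finite ?C"
    using Q_fin Y(2) \<phi>(3) by (intro finite_cartesian_product finite_PiE) auto
  have C_card: "card ?C = m ^ card Y * card (kernel \<Gamma> G \<phi>) ^ (m * card Y)"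
    using Q_fin Y(2) by (simp add: card_cartesian_product card_PiE Q_card prod_constant)
  have code_C: "code ` carrier \<Gamma> \<subseteq> ?C"
  proof (rule image_subsetI)
    fix \<gamma> assume \<gamma>: "\<gamma> \<in> carrier \<Gamma>"
    interpret a: group_hom ?F ?Q "a \<gamma>"
      by (rule a_hom[OF \<gamma>])
    have "a \<gamma> y \<in> carrier ?Q" if "y \<in> Y" for y
      using that Y(1) by (intro a.hom_closed) auto
    moreover have "j \<gamma> (sch (a \<gamma>) k y) \<otimes>\<^bsub>\<Gamma>\<^esub> inv\<^bsub>\<Gamma>\<^esub> \<theta> (sch (a \<gamma>) k y) \<in> kernel \<Gamma> G \<phi>"
      if "k \<in> carrier ?Q" "y \<in> Y" for k y
    proof -
      note s = sch_L[OF \<gamma> that]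
      show ?thesis
        using j_closed[OF \<gamma> s] \<phi>j[OF \<gamma> s] \<theta>[OF L_G[OF \<gamma> s]] L_G[OF \<gamma> s] by (simp add: kernel_def)
    qed
    ultimately show "code \<gamma> \<in> ?C"
      by (auto simp: code_def)
  qed
  \<comment> \<open>The first component fixes \<open>a \<gamma>\<close>, hence
    \<open>L \<gamma>\<close> and the Schreier elements. Only then do the second components, indexed
    by coset and generator, compare the two lifts at the same points.\<close>
  have code_inj: "\<gamma> <#\<^bsub>\<Gamma>\<^esub> (i ` K) #>\<^bsub>\<Gamma>\<^esub> inv\<^bsub>\<Gamma>\<^esub> \<gamma> = \<gamma>' <#\<^bsub>\<Gamma>\<^esub> (i ` K) #>\<^bsub>\<Gamma>\<^esub> inv\<^bsub>\<Gamma>\<^esub> \<gamma>'"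
    if \<gamma>: "\<gamma> \<in> carrier \<Gamma>" and \<gamma>': "\<gamma>' \<in> carrier \<Gamma>" and eq: "code \<gamma> = code \<gamma>'" for \<gamma> \<gamma>'
  proof -
    have "a \<gamma> y = a \<gamma>' y" if "y \<in> Y" for y
    proof -
      have "restrict (a \<gamma>) Y y = restrict (a \<gamma>') Y y"
        using eq by (simp add: code_def)
      then show ?thesis
        using that by simp
    qed
    then have "generate ?F Y \<subseteq> {x \<in> carrier ?F. a \<gamma> x = a \<gamma>' x}"
      using Y(1) hom_equalizer_subgroup[OF a_hom[OF \<gamma>] a_hom[OF \<gamma>']]
      by (intro F'.generate_subgroup_incl) auto
    then have aa: "a \<gamma> = a \<gamma>'"
      using Y(3) by (intro ext) (auto simp: a_def restrict_def)
    then have LL: "L \<gamma> = L \<gamma>'"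
      by (simp add: L_def)
    have jj: "j \<gamma> (sch (a \<gamma>) k y) = j \<gamma>' (sch (a \<gamma>) k y)" if "k \<in> carrier ?Q" "y \<in> Y" for k y
    proof -
      note s = sch_L[OF \<gamma> that]
      have "snd (code \<gamma>) (k, y) = snd (code \<gamma>') (k, y)"
        using eq by simp
      then have "j \<gamma> (sch (a \<gamma>) k y) \<otimes>\<^bsub>\<Gamma>\<^esub> inv\<^bsub>\<Gamma>\<^esub> \<theta> (sch (a \<gamma>) k y) =
          j \<gamma>' (sch (a \<gamma>) k y) \<otimes>\<^bsub>\<Gamma>\<^esub> inv\<^bsub>\<Gamma>\<^esub> \<theta> (sch (a \<gamma>) k y)"
        using that by (simp add: code_def aa)
      then show ?thesis
        using j_closed[OF \<gamma> s] j_closed[OF \<gamma>' s[unfolded LL]] \<theta>(1)[OF L_G[OF \<gamma> s]]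
        by (simp add: \<Gamma>.r_cancel)
    qed
    let ?E = "{x \<in> carrier (?F\<lparr>carrier := L \<gamma>\<rparr>). j \<gamma> x = j \<gamma>' x}"
    have "subgroup ?E (?F\<lparr>carrier := L \<gamma>\<rparr>)"
      using j_hom[OF \<gamma>] j_hom[OF \<gamma>'] unfolding LL[symmetric] by (rule hom_equalizer_subgroup)
    then have E: "subgroup ?E ?F"
      by (rule F'.incl_subgroup[OF L_sub[OF \<gamma>]])
    have "L \<gamma> \<subseteq> ?E"
      unfolding L_def
    proof (rule schreier_generation[OF a_hom[OF \<gamma>] _ _ _ _ E[unfolded L_def], where Y = Y and T = "T (a \<gamma>)"])
      show "T (a \<gamma>) k \<otimes>\<^bsub>?F\<^esub> y \<otimes>\<^bsub>?F\<^esub> inv\<^bsub>?F\<^esub> T (a \<gamma>) (k \<otimes>\<^bsub>?Q\<^esub> a \<gamma> y)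
          \<in> {x \<in> carrier (?F\<lparr>carrier := kernel ?F ?Q (a \<gamma>)\<rparr>). j \<gamma> x = j \<gamma>' x}"
        if "k \<in> carrier ?Q" "y \<in> Y" for k y
        using sch_L[OF \<gamma> that] jj[OF that] by (simp add: sch_def L_def)
    qed (use Y T[OF \<gamma>] in \<open>auto simp: T_def\<close>)
    then have "j \<gamma> x = j \<gamma>' x" if "x \<in> L \<gamma>" for x
      using that by auto
    then show ?thesis
      unfolding conj[OF \<gamma>] conj[OF \<gamma>'] LL[symmetric] by (intro image_cong) auto
  qed
  have "i ` K \<subseteq> carrier \<Gamma>"
    using i_closed by blast
  note index = \<Gamma>.rcosets_normalizer[OF this] and count = card_image_le_of_code[OF C_fin code_C code_inj]
  show "finite (rcosets\<^bsub>\<Gamma>\<^esub> (normalizer \<Gamma> (i ` K)))"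
    using index(1) count(1) by (rule iffD2)
  show "card (rcosets\<^bsub>\<Gamma>\<^esub> (normalizer \<Gamma> (i ` K))) \<le> m ^ card Y * card (kernel \<Gamma> G \<phi>) ^ (m * card Y)"
    using count(2) unfolding index(2) C_card .
qed

section \<open>The exponent and the final estimate\<close>

lemma group_exponent_pos:
  assumes "group A" "finite (carrier A)"
  shows "0 < group_exponent A" "\<And>a. a \<in> carrier A \<Longrightarrow> a [^]\<^bsub>A\<^esub> group_exponent A = \<one>\<^bsub>A\<^esub>"
proof -
  interpret group A by fact
  have "0 < order A \<and> (\<forall>a\<in>carrier A. a [^]\<^bsub>A\<^esub> order A = \<one>\<^bsub>A\<^esub>)"
    using assms(2) pow_order_eq_1 by (auto simp: order_gt_0_iff_finite)
  then have "0 < group_exponent A \<and> (\<forall>a\<in>carrier A. a [^]\<^bsub>A\<^esub> group_exponent A = \<one>\<^bsub>A\<^esub>)"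
    unfolding group_exponent_def by (rule LeastI)
  then show "0 < group_exponent A" "\<And>a. a \<in> carrier A \<Longrightarrow> a [^]\<^bsub>A\<^esub> group_exponent A = \<one>\<^bsub>A\<^esub>"
    by auto
qed

text \<open>By contraposition a nontrivial \<open>A\<close> has exponent at least 2, which makes the
  final inequality strict.\<close>

lemma group_exponent_eq_1:
  assumes "group A" "finite (carrier A)" "group_exponent A = 1"
  shows "card (carrier A) = 1"
proof -
  interpret group A by fact
  have "carrier A = {\<one>\<^bsub>A\<^esub>}"
    using group_exponent_pos(2)[OF assms(1,2)] unfolding assms(3) by auto
  then show ?thesis by simp
qed

text \<open>For trivial \<open>A\<close> both the index and \<open>B\<close> equal 1, so the strict
  inequality is claimed only for nontrivial \<open>A\<close>.\<close>

theorem lemma3p3: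
  fixes A :: "('a, 'm) monoid_scheme"
    and \<Gamma> :: "('e, 'k) monoid_scheme"
    and G :: "('g, 'l) monoid_scheme"
    and \<iota> :: "'a \<Rightarrow> 'e" and \<phi> :: "'e \<Rightarrow> 'g" and i :: "'g \<Rightarrow> 'e"
    and n g1 :: nat
    and F :: "nat \<Rightarrow> 'g set" and G1' :: "'g set" and r :: "'a set"
  assumes "comm_group A" and "finite (carrier A)"
    and "min_size_generating_set A r"
    and "1 \<le> n" and "polysurface_group G n F"
    and "surface_group_of_genus g1 (G\<lparr>carrier := F 1\<rparr>)"
    and "central_extension A \<iota> \<Gamma> \<phi> G"
    and "G1' \<lhd> G\<lparr>carrier := F 1\<rparr>"
    and "finite (rcosets\<^bsub>G\<lparr>carrier := F 1\<rparr>\<^esub> G1')"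
    and "card (rcosets\<^bsub>G\<lparr>carrier := F 1\<rparr>\<^esub> G1') \<le> group_exponent A"
    and "cyclic_group (G\<lparr>carrier := F 1\<rparr> Mod G1')"
    and "trivial_extension A \<iota> (\<Gamma>\<lparr>carrier := {x \<in> carrier \<Gamma>. \<phi> x \<in> G1'}\<rparr>) \<phi> (G\<lparr>carrier := G1'\<rparr>)"
    and "is_lift \<Gamma> \<phi> G G1' i"
  defines "N \<equiv> normalizer \<Gamma> (i ` G1')"
    and "B \<equiv> card (carrier A) ^ (2 * group_exponent A * g1) *
              (group_exponent A * fact (group_exponent A) ^ (2 * g1 + card r))"
  shows "finite (rcosets\<^bsub>\<Gamma>\<^esub> N) \<and>
    card (rcosets\<^bsub>\<Gamma>\<^esub> N) \<le> B \<and>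
    (card (carrier A) \<noteq> 1 \<longrightarrow> card (rcosets\<^bsub>\<Gamma>\<^esub> N) < B)"
proof -
  let ?F = "G\<lparr>carrier := F 1\<rparr>"
  let ?e = "group_exponent A"
  let ?c = "card (carrier A)"
  define m where "m = card (rcosets\<^bsub>?F\<^esub> G1')"
  have A: "group A"
    using assms(1) by (rule comm_group.axioms)
  have "group G" and F: "F 1 \<lhd> G"
    using assms(4,5) unfolding polysurface_group_def by auto
  have "group ?F"
    using normal_imp_subgroup[OF F] \<open>group G\<close> by (rule subgroup.subgroup_is_group)
  then obtain Y where Y: "Y \<subseteq> carrier ?F" "finite Y" "card Y \<le> 2 * g1" "generate ?F Y = carrier ?F"
    using surface_group_generators[OF assms(6)] by blast
  have \<phi>: "group_hom \<Gamma> G \<phi>" "\<phi> ` carrier \<Gamma> = carrier G"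
    and ker: "kernel \<Gamma> G \<phi> = \<iota> ` carrier A" and inj: "inj_on \<iota> (carrier A)"
    using assms(7) by (auto simp: central_extension_def group_hom_def group_hom_axioms_def)
  have ker_fin: "finite (kernel \<Gamma> G \<phi>)" and ker_card: "card (kernel \<Gamma> G \<phi>) = ?c"
    using assms(2) card_image[OF inj] by (simp_all add: ker)
  have Y_F: "Y \<subseteq> F 1" "generate ?F Y = F 1"
    using Y by simp_all
  note index = lift_normalizer_index[OF \<phi> ker_fin F Y_F(1) Y(2) Y_F(2) assms(8,9,13),
      folded N_def m_def, unfolded ker_card]
  have m: "m \<le> ?e"
    using assms(10) by (simp add: m_def)
  have e: "0 < ?e"
    using group_exponent_pos(1)[OF A assms(2)] .
  have c: "0 < ?c"
    using assms(2) A by (auto simp: card_gt_0_iff dest: group.is_monoid monoid.one_closed)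
  have fact_ge: "?e \<le> fact ?e"
    by (rule fact_ge_self)
  \<comment> \<open>The number of conjugates of \<open>G1'\<close> is absorbed by the power of the
    factorial, since \<open>?e\<close> is at most \<open>fact ?e\<close>.\<close>
  have "m ^ card Y \<le> ?e ^ card Y"
    using m by (rule power_mono) simp
  also have "\<dots> \<le> ?e ^ (2 * g1 + card r)"
    using e Y(3) by (intro power_increasing) auto
  also have "\<dots> \<le> fact ?e ^ (2 * g1 + card r)"
    using fact_ge by (rule power_mono) simp
  finally have 1: "m ^ card Y \<le> fact ?e ^ (2 * g1 + card r)" .
  have "m * card Y \<le> ?e * (2 * g1)"
    using m Y(3) by (rule mult_le_mono)
  then have "?c ^ (m * card Y) \<le> ?c ^ (2 * ?e * g1)"
    using c by (intro power_increasing) (auto simp: ac_simps)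
  with 1 have "m ^ card Y * ?c ^ (m * card Y) \<le> fact ?e ^ (2 * g1 + card r) * ?c ^ (2 * ?e * g1)"
    by (rule mult_le_mono)
  then have bound: "card (rcosets\<^bsub>\<Gamma>\<^esub> N) \<le> fact ?e ^ (2 * g1 + card r) * ?c ^ (2 * ?e * g1)"
    using index(2) by (rule le_trans[rotated])
  have B: "B = ?e * (fact ?e ^ (2 * g1 + card r) * ?c ^ (2 * ?e * g1))"
    by (simp add: B_def)
  have pos: "0 < fact ?e ^ (2 * g1 + card r) * ?c ^ (2 * ?e * g1)"
    using c by simp
  have "card (rcosets\<^bsub>\<Gamma>\<^esub> N) \<le> B"
    using bound e unfolding B by (metis Suc_leI One_nat_def le_trans mult_le_mono1 nat_mult_1)
  moreover have "card (rcosets\<^bsub>\<Gamma>\<^esub> N) < B" if "?c \<noteq> 1"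
  proof -
    \<comment> \<open>The count is already bounded by the other factors of \<open>B\<close>, so this
      remaining factor gives strictness.\<close>
    have "1 < ?e"
      using e that group_exponent_eq_1[OF A assms(2)] by force
    then have "1 * (fact ?e ^ (2 * g1 + card r) * ?c ^ (2 * ?e * g1)) < B"
      unfolding B using pos by (rule mult_strict_right_mono)
    then show ?thesis
      using bound by linarith
  qed
  ultimately show ?thesis
    using index(1) by blast
qed

end
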